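(* There is a universal constant $C$ such that the following holds. Let $F\colon\mathcal{X}\times\mathcal{Y}\to\{+1,-1\}$ be a (possibly partial) communication function with $\mathcal{X},\mathcal{Y}$ finite, and suppose $\log\widetilde{\mathrm{rank}}(F)\ge C\log\log|\mathcal{X}\times\mathcal{Y}|$. Then there is a distribution $\mu$ over $\mathrm{Dom}(F)$ such that for every real matrix $A$ indexed by $\mathcal{X}\times\mathcal{Y}$ with $|A[x,y]|\le1$ for all entries, \[\mathbb{E}_{(x,y)\sim\mu}[F(x,y)A[x,y]]\le\frac{\log\mathrm{rank}(A)}{\tilde{\Omega}(\log\widetilde{\mathrm{rank}}(F))},\] with universal constants in the $\tilde{\Omega}$.
   Context: $\widetilde{\mathrm{rank}}(F)$ is the approximate rank: the minimum rank of a real matrix $A$ with $|A[x,y]|\le1$ for all $(x,y)\in\mathcal{X}\times\mathcal{Y}$ and $F(x,y)A[x,y]\ge1/3$ for all $(x,y)\in\mathrm{Dom}(F)$. $\tilde{\Omega}$ hides factors polylogarithmic in $\log\widetilde{\mathrm{rank}}(F)$.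
   Formalization: log rank(A) is read as log max(2, rank(A)), since for rank 1 the literal bound 0 fails (single nonzero entry F(x,y) at a point of positive probability); Dom(F) is assumed nonempty, and the bound is claimed only when the log of the approximate rank is positive. *)

theory Defs
  imports
    "HOL-Probability.Probability_Mass_Function"
    "Jordan_Normal_Form.DL_Rank"
begin

text \<open>The finite sets \<open>\<X>\<close> and \<open>\<Y>\<close> are enumerated as \<open>{..<n}\<close> and \<open>{..<m}\<close>. Index sets of this form,
  rather than finite index types, are needed because the universal constants of the theorem are
  quantified outside of the choice of \<open>\<X>\<close> and \<open>\<Y>\<close>. The domain of the partial function is \<open>dom F\<close>.\<close>

definition comm_fun :: "nat \<Rightarrow> nat \<Rightarrow> (nat \<times> nat \<rightharpoonup> real) \<Rightarrow> bool" where
  "comm_fun n m F \<longleftrightarrow> dom F \<subseteq> {..<n} \<times> {..<m} \<and> ran F \<subseteq> {1, -1}"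

definition unit_bounded_mats :: "nat \<Rightarrow> nat \<Rightarrow> real mat set" where
  "unit_bounded_mats n m = {A \<in> carrier_mat n m. \<forall>x<n. \<forall>y<m. \<bar>A $$ (x, y)\<bar> \<le> 1}"

definition mat_rank :: "real mat \<Rightarrow> nat" where
  "mat_rank A = vec_space.rank (dim_row A) A"

definition approximating_mats :: "nat \<Rightarrow> nat \<Rightarrow> (nat \<times> nat \<rightharpoonup> real) \<Rightarrow> real mat set" where
  "approximating_mats n m F =
     {A \<in> unit_bounded_mats n m. \<forall>(x, y) \<in> dom F. the (F (x, y)) * A $$ (x, y) \<ge> 1 / 3}"

definition approx_rank :: "nat \<Rightarrow> nat \<Rightarrow> (nat \<times> nat \<rightharpoonup> real) \<Rightarrow> nat" where
  "approx_rank n m F = (LEAST r. \<exists>A \<in> approximating_mats n m F. mat_rank A = r)"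

lemma approximating_mats_nonempty:
  assumes "comm_fun n m F"
  shows "approximating_mats n m F \<noteq> {}"
proof -
  let ?A = "mat n m (\<lambda>p. case F p of None \<Rightarrow> 0 | Some v \<Rightarrow> v)"
  have val: "v = 1 \<or> v = -1" if "F p = Some v" for p v
    using assms that by (auto simp: comm_fun_def ran_def)
  have "\<bar>?A $$ (x, y)\<bar> \<le> 1" if "x < n" "y < m" for x y
    using that val[of "(x, y)"] by (auto split: option.split)
  moreover have "1 / 3 \<le> the (F (x, y)) * ?A $$ (x, y)" if "(x, y) \<in> dom F" for x y
  proof -
    have "x < n" "y < m" using assms that by (auto simp: comm_fun_def)
    then show ?thesis using that val[of "(x, y)"] by auto
  qed
  moreover have "?A \<in> carrier_mat n m" by simp
  ultimately have "?A \<in> approximating_mats n m F"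
    unfolding approximating_mats_def unit_bounded_mats_def by blast
  then show ?thesis by blast
qed

lemma approx_rank_attained:
  assumes "comm_fun n m F"
  obtains A where "A \<in> approximating_mats n m F" "mat_rank A = approx_rank n m F"
  using LeastI_ex[of "\<lambda>r. \<exists>A \<in> approximating_mats n m F. mat_rank A = r"]
    approximating_mats_nonempty[OF assms] unfolding approx_rank_def by blast

text \<open>A function in \<open>\<Omega>\<close>-tilde of \<open>t\<close>, with explicit constant \<open>c\<close> and polylogarithmic exponent \<open>k\<close>. The
  shift by \<open>2\<close> keeps the logarithm at least \<open>1\<close> for all \<open>t \<ge> 0\<close>.\<close>

definition soft_Omega :: "real \<Rightarrow> nat \<Rightarrow> real \<Rightarrow> real" where
  "soft_Omega c k t = c * t / log 2 (t + 2) ^ k"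

text \<open>For rank at least \<open>2\<close> this is the binary logarithm of the rank. It is \<open>1\<close> instead of \<open>0\<close>
  for rank \<open>1\<close>: a matrix with the single nonzero entry \<open>F(x,y)\<close> at a point \<open>(x,y)\<close> of positive
  probability has rank \<open>1\<close> and positive correlation with \<open>F\<close>, so a bound of \<open>0\<close> cannot hold
  for any distribution.\<close>

definition log_rank :: "real mat \<Rightarrow> real" where
  "log_rank A = log 2 (real (max 2 (mat_rank A)))"

end

theory Submission
  imports Defs
begin

text \<open>
  Suppose that every distribution on \<open>dom F\<close> admits a matrix \<open>A\<close> whose correlation with \<open>F\<close> exceeds
  \<open>log_rank A / T\<close>. By the minimax principle, in the form of multiplicative weights, some convex
  combination \<open>S\<close> of matrices \<open>A / log_rank A\<close> satisfies \<open>F * S \<ge> 1 / (2 * T)\<close> on \<open>dom F\<close>. Applying to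
  the entries of \<open>S\<close> an integrated Fejer kernel of degree \<open>n = O(T)\<close>, a trigonometric polynomial up to a
  linear term that approximates the sign function away from an interval of length \<open>O(1 / T)\<close>, gives an
  approximation of \<open>F\<close>.

  To control the rank, split \<open>S\<close> dyadically into parts \<open>S i\<close> built from the matrices with
  \<open>log_rank A \<approx> 2 ^ i\<close>. The entries of \<open>S i\<close> are at most \<open>2 ^ - i\<close>, so in
  \<open>exp (\<i> * d * S) = (\<Prod>i. exp (\<i> * d * S i))\<close> the \<open>i\<close>-th factor may be truncated to a polynomial of
  degree about \<open>n / 2 ^ i + log T\<close>. The result is a combination, of total mass \<open>exp (O(T))\<close>, of bounded
  matrices with log-rank \<open>O(T * log T)\<close>. Sampling \<open>exp (O(T)) * log (n * m)\<close> of these yields an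
  approximation of \<open>F\<close> of log-rank \<open>O(T * log T) + log (log (n * m))\<close>, which is less than
  \<open>log (approx_rank n m F)\<close> for a suitable \<open>T\<close>.
\<close>

subsection \<open>Multiplicative weights\<close>

text \<open>For negative \<open>x\<close> put \<open>y = - x\<close> and invert the quadratic Taylor
  lower bound of \<open>exp y\<close>: the product of \<open>1 - y + y\<^sup>2\<close> and
  \<open>1 + y + y\<^sup>2 / 2\<close> is at least 1.\<close>

lemma exp_le_quadratic:
  fixes x :: real
  assumes "\<bar>x\<bar> \<le> 1"
  shows "exp x \<le> 1 + x + x\<^sup>2"
proof (cases "x \<ge> 0")
  case True
  then show ?thesis using assms exp_bound[of x] by simp
next
  case False
  define y where "y = - x"
  have y: "0 \<le> y" using False by (simp add: y_def)
  have "1 + y + y\<^sup>2 / 2 \<le> exp y" by (rule exp_lower_Taylor_quadratic[OF y])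
  moreover have pos: "0 < 1 + y + y\<^sup>2 / 2" using y by (simp add: add_pos_nonneg)
  ultimately have "exp (- y) \<le> 1 / (1 + y + y\<^sup>2 / 2)"
    by (simp add: exp_minus divide_simps)
  also have "\<dots> \<le> 1 - y + y\<^sup>2"
  proof -
    have "(1 - y + y\<^sup>2) * (1 + y + y\<^sup>2 / 2) = 1 + (y^2 + y^3 + y^4) / 2"
      by (simp add: field_simps power2_eq_square power3_eq_cube power4_eq_xxxx)
    also have "\<dots> \<ge> 1" using y by simp
    finally show ?thesis using pos by (simp add: divide_le_eq)
  qed
  finally show ?thesis by (simp add: y_def)
qed

text \<open>The \<open>i\<close>-th element is a best response to the weights \<open>exp (- l * (sum of the earlier values))\<close>, whose
  total is the potential that the induction bounds.\<close>

lemma multiplicative_weights: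
  fixes val :: "'a \<Rightarrow> 'e \<Rightarrow> real"
  assumes E: "finite E" "E \<noteq> {}"
    and l: "0 < l" "l \<le> 1"
    and N: "ln (card E) \<le> l\<^sup>2 * real N"
    and bounded: "\<And>a e. a \<in> S \<Longrightarrow> e \<in> E \<Longrightarrow> \<bar>val a e\<bar> \<le> 1"
    and response: "\<And>w. (\<And>e. e \<in> E \<Longrightarrow> 0 < w e) \<Longrightarrow>
                    \<exists>a\<in>S. d * (\<Sum>e\<in>E. w e) \<le> (\<Sum>e\<in>E. w e * val a e)"
  shows "\<exists>a. (\<forall>i<N. a i \<in> S) \<and> (\<forall>e\<in>E. real N * (d - 2 * l) \<le> (\<Sum>i<N. val (a i) e))"
proof -
  have "\<exists>a. (\<forall>i<k. a i \<in> S) \<and>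
          (\<Sum>e\<in>E. exp (- l * (\<Sum>i<k. val (a i) e))) \<le> card E * exp (real k * (l\<^sup>2 - l * d))" for k
  proof (induction k)
    case 0
    show ?case by simp
  next
    case (Suc k)
    then obtain a where a: "\<forall>i<k. a i \<in> S"
      and pot: "(\<Sum>e\<in>E. exp (- l * (\<Sum>i<k. val (a i) e))) \<le> card E * exp (real k * (l\<^sup>2 - l * d))"
      by blast
    define w where "w e = exp (- l * (\<Sum>i<k. val (a i) e))" for e
    obtain b where b: "b \<in> S" "d * (\<Sum>e\<in>E. w e) \<le> (\<Sum>e\<in>E. w e * val b e)"
      using response[of w] by (auto simp: w_def)
    define a' where "a' = a(k := b)"
    have same: "(\<Sum>i<k. val (a' i) e) = (\<Sum>i<k. val (a i) e)" for e
      by (intro sum.cong) (auto simp: a'_def)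
    have "(\<Sum>e\<in>E. exp (- l * (\<Sum>i<Suc k. val (a' i) e))) = (\<Sum>e\<in>E. w e * exp (- l * val b e))"
      by (simp add: same w_def exp_add[symmetric] algebra_simps)
        (simp add: a'_def)
    \<comment> \<open>Second-order expansion of the update: the linear term is the payoff of the
      response \<open>b\<close>, and the quadratic term is at most \<open>l\<^sup>2\<close> because
      values are bounded by 1.\<close>
    also have "\<dots> \<le> (\<Sum>e\<in>E. w e * (1 + l\<^sup>2) - l * (w e * val b e))"
    proof (rule sum_mono)
      fix e assume e: "e \<in> E"
      have v: "\<bar>val b e\<bar> \<le> 1" using bounded b(1) e by blast
      then have "\<bar>- l * val b e\<bar> \<le> 1" using l mult_le_one[of l "\<bar>val b e\<bar>"] by (simp add: abs_mult)
      then have "exp (- l * val b e) \<le> 1 - l * val b e + l\<^sup>2 * (val b e)\<^sup>2"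
        using exp_le_quadratic[of "- l * val b e"] by (simp add: power_mult_distrib)
      also have "\<dots> \<le> 1 - l * val b e + l\<^sup>2"
        using v by (simp add: mult_left_le abs_square_le_1)
      finally have "w e * exp (- l * val b e) \<le> w e * (1 - l * val b e + l\<^sup>2)"
        by (intro mult_left_mono) (auto simp: w_def)
      then show "w e * exp (- l * val b e) \<le> w e * (1 + l\<^sup>2) - l * (w e * val b e)"
        by (simp add: algebra_simps)
    qed
    also have "\<dots> = (\<Sum>e\<in>E. w e) * (1 + l\<^sup>2) - l * (\<Sum>e\<in>E. w e * val b e)"
      by (simp add: sum_subtractf sum_distrib_left sum_distrib_right)
    also have "\<dots> \<le> (\<Sum>e\<in>E. w e) * (1 + l\<^sup>2) - l * (d * (\<Sum>e\<in>E. w e))"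
      using b(2) l by (simp add: mult_left_mono)
    also have "\<dots> = (\<Sum>e\<in>E. w e) * (1 + (l\<^sup>2 - l * d))" by (simp add: algebra_simps)
    also have "\<dots> \<le> (\<Sum>e\<in>E. w e) * exp (l\<^sup>2 - l * d)"
      by (intro mult_left_mono exp_ge_add_one_self sum_nonneg) (auto simp: w_def)
    also have "\<dots> \<le> card E * exp (real k * (l\<^sup>2 - l * d)) * exp (l\<^sup>2 - l * d)"
      using pot by (intro mult_right_mono) (auto simp: w_def)
    also have "\<dots> = card E * exp (real (Suc k) * (l\<^sup>2 - l * d))"
      by (simp add: exp_add[symmetric] algebra_simps)
    finally show ?case using a b(1) by (intro exI[of _ a']) (auto simp: a'_def less_Suc_eq)
  qed
  then obtain a where a: "\<forall>i<N. a i \<in> S"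
    and pot: "(\<Sum>e\<in>E. exp (- l * (\<Sum>i<N. val (a i) e))) \<le> card E * exp (real N * (l\<^sup>2 - l * d))"
    by blast
  have "real N * (d - 2 * l) \<le> (\<Sum>i<N. val (a i) e)" if e: "e \<in> E" for e
  proof -
    \<comment> \<open>One term is at most the whole potential, so taking logarithms bounds every
      \<open>e\<close> separately. By the choice of \<open>N\<close>, \<open>ln (card E)\<close>
      costs at most another \<open>l\<^sup>2 * N\<close>, which explains the loss of
      \<open>2 * l\<close> per round.\<close>
    have "exp (- l * (\<Sum>i<N. val (a i) e)) \<le> (\<Sum>e\<in>E. exp (- l * (\<Sum>i<N. val (a i) e)))"
      using E e by (intro member_le_sum) auto
    also note pot
    also have "card E * exp (real N * (l\<^sup>2 - l * d)) = exp (ln (card E) + real N * (l\<^sup>2 - l * d))"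
      using E by (simp add: exp_add card_gt_0_iff)
    finally have "- l * (\<Sum>i<N. val (a i) e) \<le> ln (card E) + real N * (l\<^sup>2 - l * d)" by simp
    also have "\<dots> \<le> l * (real N * (2 * l - d))"
      using N by (simp add: algebra_simps power2_eq_square)
    finally have "l * (real N * (d - 2 * l)) \<le> l * (\<Sum>i<N. val (a i) e)" by (simp add: algebra_simps)
    then show ?thesis using l by simp
  qed
  then show ?thesis using a by blast
qed

subsection \<open>Approximating the sign function\<close>

text \<open>The square of the modulus of the sum of \<open>cis (k * z)\<close> over
  \<open>k < n\<close>, divided by \<open>n\<close>, is written out as a double sum. Integrated
  termwise it becomes a sum of sines with frequencies of absolute value below \<open>n\<close>, each
  of which is made a mixture later.\<close>

definition fejer_kernel :: "nat \<Rightarrow> real \<Rightarrow> real" where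
  "fejer_kernel n z = (\<Sum>j<n. \<Sum>k<n. cos ((real j - real k) * z)) / real n"

text \<open>An antiderivative of \<open>cos (d * z)\<close> that vanishes at 0. The case
  \<open>d = 0\<close> arises on the diagonal \<open>j = k\<close> and is the linear term of the
  integrated kernel.\<close>

definition sin_over :: "real \<Rightarrow> real \<Rightarrow> real" where
  "sin_over d z = (if d = 0 then z else sin (d * z) / d)"

definition fejer_integral :: "nat \<Rightarrow> real \<Rightarrow> real" where
  "fejer_integral n z = (\<Sum>j<n. \<Sum>k<n. sin_over (real j - real k) z) / real n"

lemma DERIV_sin_over: "(sin_over d has_real_derivative cos (d * z)) (at z)"
proof (cases "d = 0")
  case True
  then have "sin_over d = (\<lambda>z. z)" by (auto simp: sin_over_def)
  then show ?thesis using True by simp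
next
  case False
  then have "sin_over d = (\<lambda>z. sin (d * z) / d)" by (auto simp: sin_over_def)
  moreover have "((\<lambda>z. sin (d * z) / d) has_real_derivative cos (d * z)) (at z)"
    using False by (auto intro!: derivative_eq_intros)
  ultimately show ?thesis by simp
qed

lemma DERIV_fejer_integral:
  "(fejer_integral n has_real_derivative fejer_kernel n z) (at z)"
  unfolding fejer_integral_def[abs_def] fejer_kernel_def
  by (intro DERIV_cdivide DERIV_sum DERIV_sin_over)

lemma fejer_kernel_eq_norm:
  "fejer_kernel n z = (norm (\<Sum>k<n. cis (real k * z)))\<^sup>2 / real n"
proof -
  let ?s = "\<Sum>k<n. cis (real k * z)"
  have "complex_of_real ((norm ?s)\<^sup>2) = ?s * cnj ?s" by (rule complex_norm_square)
  also have "\<dots> = (\<Sum>j<n. \<Sum>k<n. cis ((real j - real k) * z))"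
    by (simp add: cis_cnj sum_product cis_mult algebra_simps)
  finally have "Re (complex_of_real ((norm ?s)\<^sup>2)) = (\<Sum>j<n. \<Sum>k<n. cos ((real j - real k) * z))"
    by simp
  then show ?thesis by (simp add: fejer_kernel_def)
qed

lemma fejer_kernel_nonneg: "0 \<le> fejer_kernel n z"
  by (simp add: fejer_kernel_eq_norm)

text \<open>All arguments \<open>(j - k) * z\<close> are at most \<open>n * z\<close>, hence below
  \<open>pi / 3\<close> in absolute value, so each of the \<open>n\<^sup>2\<close> cosines is at
  least 1/2.\<close>

lemma fejer_kernel_ge:
  assumes "0 \<le> z" "real n * z \<le> 1"
  shows "real n / 2 \<le> fejer_kernel n z"
proof (cases "n = 0")
  case False
  have "1 / 2 \<le> cos ((real j - real k) * z)" if "j < n" "k < n" for j k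
  proof -
    have "\<bar>real j - real k\<bar> \<le> real n" using that by auto
    then have "\<bar>real j - real k\<bar> * z \<le> real n * z"
      using assms(1) by (rule mult_right_mono)
    then have le: "\<bar>(real j - real k) * z\<bar> \<le> pi / 3"
      using assms pi_gt3 by (simp add: abs_mult)
    have "cos (pi / 3) \<le> cos \<bar>(real j - real k) * z\<bar>"
      using le pi_gt_zero by (intro cos_monotone_0_pi_le) auto
    then show ?thesis by (simp add: cos_60)
  qed
  then have "(\<Sum>j<n. \<Sum>k<n. 1 / 2) \<le> (\<Sum>j<n. \<Sum>k<n. cos ((real j - real k) * z))"
    by (intro sum_mono) auto
  then show ?thesis using False by (simp add: fejer_kernel_def field_simps)
qed (simp add: fejer_kernel_def)

lemma half_le_sin:
  fixes z :: real
  assumes "0 \<le> z" "z \<le> 1"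
  shows "z / 2 \<le> sin z"
proof -
  have "(\<lambda>z. sin z - z / 2) 0 \<le> (\<lambda>z. sin z - z / 2) z"
  proof (rule DERIV_nonneg_imp_nondecreasing[where f = "\<lambda>z. sin z - z / 2"])
    fix x assume x: "0 \<le> x" "x \<le> z"
    have "cos (pi / 3) \<le> cos x"
      using x assms pi_gt3 by (intro cos_monotone_0_pi_le) auto
    then have "0 \<le> cos x - 1 / 2" by (simp add: cos_60)
    moreover have "((\<lambda>z. sin z - z / 2) has_real_derivative cos x - 1 / 2) (at x)"
      by (auto intro!: derivative_eq_intros)
    ultimately show "\<exists>y. ((\<lambda>z. sin z - z / 2) has_real_derivative y) (at x) \<and> 0 \<le> y" by blast
  qed (use assms in simp)
  then show ?thesis by simp
qed

text \<open>Geometric series: the exponential sum times \<open>cis z - 1\<close> is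
  \<open>cis z ^ n - 1\<close>, of norm at most 2, while \<open>cis z - 1\<close> has norm at least
  its imaginary part \<open>sin z\<close>, which is at least \<open>z / 2\<close>.\<close>

lemma fejer_kernel_le:
  assumes "0 < z" "z \<le> 1"
  shows "fejer_kernel n z \<le> 16 / (real n * z\<^sup>2)"
proof -
  let ?s = "\<Sum>k<n. cis (real k * z)"
  have "z / 2 \<le> norm (cis z - 1)"
    using half_le_sin[of z] assms abs_Im_le_cmod[of "cis z - 1"] by simp
  then have "norm ?s * (z / 2) \<le> norm ?s * norm (cis z - 1)"
    by (intro mult_left_mono) auto
  also have "\<dots> = norm (cis z ^ n - 1)"
  proof -
    have "(cis z - 1) * (\<Sum>k<n. cis z ^ k) = cis z ^ n - 1"
      by (simp add: power_diff_1_eq)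
    moreover have "(\<Sum>k<n. cis z ^ k) = ?s" by (intro sum.cong) (auto simp: Complex.DeMoivre)
    ultimately show ?thesis by (metis norm_mult mult.commute)
  qed
  also have "\<dots> \<le> 2" using norm_triangle_ineq4[of "cis z ^ n" 1] by (simp add: norm_power)
  finally have "norm ?s \<le> 4 / z" using assms by (simp add: field_simps)
  then have "(norm ?s)\<^sup>2 \<le> (4 / z)\<^sup>2" by (intro power_mono) auto
  then have "(norm ?s)\<^sup>2 / real n \<le> (4 / z)\<^sup>2 / real n" by (intro divide_right_mono) auto
  then show ?thesis by (simp add: fejer_kernel_eq_norm power_divide mult.commute)
qed

lemma fejer_integral_mono: "x \<le> y \<Longrightarrow> fejer_integral n x \<le> fejer_integral n y"
  by (rule DERIV_nonneg_imp_nondecreasing) (auto intro: DERIV_fejer_integral fejer_kernel_nonneg)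

lemma fejer_integral_0: "fejer_integral n 0 = 0"
  by (simp add: fejer_integral_def sin_over_def)

lemma fejer_integral_minus: "fejer_integral n (- z) = - fejer_integral n z"
proof -
  have "sin_over d (- z) = - sin_over d z" for d by (simp add: sin_over_def)
  then show ?thesis by (simp add: fejer_integral_def sum_negf)
qed

text \<open>The kernel is at least \<open>n / 2\<close> on an interval of length
  \<open>1 / n\<close>. Here and below, monotonicity of a difference or a sum takes the place of
  comparing integrals.\<close>

lemma fejer_integral_ge_half:
  assumes "1 \<le> real n * z"
  shows "1 / 2 \<le> fejer_integral n z"
proof -
  have n: "n > 0" using assms by (cases n) auto
  have "(\<lambda>z. fejer_integral n z - real n / 2 * z) 0 \<le> (\<lambda>z. fejer_integral n z - real n / 2 * z) (1 / n)"
  proof (rule DERIV_nonneg_imp_nondecreasing[where f = "\<lambda>z. fejer_integral n z - real n / 2 * z"])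
    fix x assume x: "0 \<le> x" "x \<le> 1 / real n"
    have "((\<lambda>z. fejer_integral n z - real n / 2 * z) has_real_derivative
            fejer_kernel n x - real n / 2) (at x)"
      by (auto intro!: derivative_eq_intros DERIV_fejer_integral)
    moreover have "real n / 2 \<le> fejer_kernel n x"
      using x n by (intro fejer_kernel_ge) (auto simp: field_simps)
    ultimately show "\<exists>y. ((\<lambda>z. fejer_integral n z - real n / 2 * z) has_real_derivative y) (at x) \<and> 0 \<le> y"
      by (intro exI[of _ "fejer_kernel n x - real n / 2"]) auto
  qed simp
  then have "1 / 2 \<le> fejer_integral n (1 / n)" using n by (simp add: fejer_integral_0)
  also have "\<dots> \<le> fejer_integral n z"
    using n assms by (intro fejer_integral_mono) (simp add: field_simps)
  finally show ?thesis .
qed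

text \<open>The decay \<open>16 / (n * x\<^sup>2)\<close> integrated from \<open>z\<close> to 1:
  adding the antiderivative term \<open>16 / (n * x)\<close> makes the function
  nonincreasing.\<close>

lemma fejer_integral_tail:
  assumes "0 < z" "z \<le> 1"
  shows "fejer_integral n 1 - fejer_integral n z \<le> 16 / (real n * z)"
proof (cases "n = 0")
  case False
  let ?h = "\<lambda>x. fejer_integral n x + 16 / real n * inverse x"
  have "?h 1 \<le> ?h z"
  proof (rule DERIV_nonpos_imp_nonincreasing[where f = ?h])
    fix x assume x: "z \<le> x" "x \<le> 1"
    then have x0: "0 < x" using assms by simp
    have "(?h has_real_derivative fejer_kernel n x + 16 / real n * (- (inverse x ^ Suc (Suc 0)))) (at x)"
      using x0 by (intro DERIV_add DERIV_cmult DERIV_fejer_integral DERIV_inverse) auto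
    moreover have "fejer_kernel n x + 16 / real n * (- (inverse x ^ Suc (Suc 0))) \<le> 0"
      using fejer_kernel_le[of x n] x x0 by (simp add: field_simps power2_eq_square)
    ultimately show "\<exists>y. (?h has_real_derivative y) (at x) \<and> y \<le> 0" by blast
  qed (use assms in auto)
  then have "fejer_integral n 1 + 16 / real n \<le> fejer_integral n z + 16 / (real n * z)"
    by (simp add: divide_inverse)
  moreover have "0 \<le> 16 / real n" by simp
  ultimately show ?thesis by linarith
qed (simp add: fejer_integral_def)

lemma abs_fejer_integral_le:
  assumes "\<bar>z\<bar> \<le> 1"
  shows "\<bar>fejer_integral n z\<bar> \<le> fejer_integral n 1"
  using fejer_integral_mono[of z 1 n] fejer_integral_mono[of "-1" z n] assms
  by (simp add: fejer_integral_minus abs_le_iff)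

text \<open>With \<open>n * d\<close> at least 64 the tail is at most 1/4, which is at most half of
  the value at \<open>z\<close>. So the value at 1 exceeds the value at \<open>z\<close> by at most
  half of the latter.\<close>

lemma fejer_integral_step:
  assumes "64 \<le> real n * d" "0 < d" "d \<le> z" "z \<le> 1"
  shows "2 / 3 * fejer_integral n 1 \<le> fejer_integral n z"
proof -
  have n: "n > 0" using assms by (cases n) auto
  have "fejer_integral n 1 - fejer_integral n z \<le> 16 / (real n * z)"
    using assms by (intro fejer_integral_tail) auto
  also have "\<dots> \<le> 16 / 64"
  proof (rule divide_left_mono)
    show "64 \<le> real n * z" using assms mult_left_mono[of d z "real n"] by simp
    then show "0 < real n * z * 64" by simp
  qed simp
  finally have "fejer_integral n 1 - fejer_integral n z \<le> 1 / 4" by simp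
  moreover have "1 / 2 \<le> fejer_integral n z"
    using assms mult_left_mono[of d z "real n"] by (intro fejer_integral_ge_half) simp
  ultimately show ?thesis by simp
qed

subsection \<open>Rank factorizations\<close>

text \<open>Rank at most \<open>r\<close>, witnessed by a list of outer products and free of
  dimensions. Sums and entrywise products of matrices then become concatenations and products of
  lists.\<close>

definition factorable :: "nat \<Rightarrow> (nat \<Rightarrow> nat \<Rightarrow> real) \<Rightarrow> bool" where
  "factorable r X \<longleftrightarrow> (\<exists>uvs. length uvs \<le> r \<and> (\<forall>x y. X x y = (\<Sum>(u, v)\<leftarrow>uvs. u x * v y)))"

lemma factorable_mono: "factorable r X \<Longrightarrow> r \<le> s \<Longrightarrow> factorable s X"
  unfolding factorable_def by (meson order_trans)

lemma factorable_0: "factorable r (\<lambda>x y. 0)"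
  unfolding factorable_def by (intro exI[of _ "[]"]) auto

lemma factorable_const: "1 \<le> r \<Longrightarrow> factorable r (\<lambda>x y. c)"
  unfolding factorable_def by (intro exI[of _ "[(\<lambda>x. c, \<lambda>y. 1)]"]) auto

lemma factorable_cmult:
  assumes "factorable r X"
  shows "factorable r (\<lambda>x y. c * X x y)"
proof -
  obtain uvs where uvs: "length uvs \<le> r" "\<forall>x y. X x y = (\<Sum>(u, v)\<leftarrow>uvs. u x * v y)"
    using assms unfolding factorable_def by blast
  show ?thesis unfolding factorable_def
    using uvs by (intro exI[of _ "map (\<lambda>(u, v). (\<lambda>x. c * u x, v)) uvs"])
      (auto simp: sum_list_const_mult[symmetric] comp_def case_prod_beta mult.assoc)
qed

lemma factorable_add:
  assumes "factorable r X" "factorable s Y"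
  shows "factorable (r + s) (\<lambda>x y. X x y + Y x y)"
proof -
  obtain us vs where "length us \<le> r" "\<forall>x y. X x y = (\<Sum>(u, v)\<leftarrow>us. u x * v y)"
    "length vs \<le> s" "\<forall>x y. Y x y = (\<Sum>(u, v)\<leftarrow>vs. u x * v y)"
    using assms unfolding factorable_def by blast
  then show ?thesis unfolding factorable_def by (intro exI[of _ "us @ vs"]) auto
qed

lemma factorable_sum:
  assumes "finite I" "\<And>i. i \<in> I \<Longrightarrow> factorable r (X i)"
  shows "factorable (card I * r) (\<lambda>x y. \<Sum>i\<in>I. X i x y)"
  using assms
proof (induction I rule: finite_induct)
  case (insert i I)
  then show ?case using factorable_add[of r "X i" "card I * r"] by simp
qed (simp add: factorable_0)

lemma sum_list_product:
  fixes f :: "'a \<Rightarrow> 'c::semiring_0" and g :: "'b \<Rightarrow> 'c"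
  shows "(\<Sum>a\<leftarrow>xs. f a) * (\<Sum>b\<leftarrow>ys. g b) = (\<Sum>p\<leftarrow>List.product xs ys. f (fst p) * g (snd p))"
  by (induction xs) (auto simp: distrib_right comp_def sum_list_const_mult)

text \<open>The entrywise product of two outer products is again an outer product, so expanding
  gives one for each pair.\<close>

lemma factorable_mult:
  assumes "factorable r X" "factorable s Y"
  shows "factorable (r * s) (\<lambda>x y. X x y * Y x y)"
proof -
  obtain us vs where us: "length us \<le> r" "\<forall>x y. X x y = (\<Sum>(u, v)\<leftarrow>us. u x * v y)"
    and vs: "length vs \<le> s" "\<forall>x y. Y x y = (\<Sum>(u, v)\<leftarrow>vs. u x * v y)"
    using assms unfolding factorable_def by blast
  let ?ws = "map (\<lambda>((u, v), (u', v')). (\<lambda>x. u x * u' x, \<lambda>y. v y * v' y)) (List.product us vs)"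
  have "X x y * Y x y = (\<Sum>(u, v)\<leftarrow>?ws. u x * v y)" for x y
    using us(2) vs(2) by (simp add: sum_list_product comp_def case_prod_beta mult_ac)
  moreover have "length ?ws \<le> r * s" using us(1) vs(1) by (simp add: mult_le_mono)
  ultimately show ?thesis unfolding factorable_def by blast
qed

text \<open>A maximal independent set \<open>U\<close> of columns has as many elements as the rank
  and spans every column, so the coefficients with respect to \<open>U\<close> form the second
  factors. Extension by 0 keeps entry bounds valid at all indices.\<close>

lemma factorable_mat_rank:
  assumes A: "A \<in> carrier_mat n m"
  shows "factorable (mat_rank A) (\<lambda>x y. if x < n \<and> y < m then A $$ (x, y) else 0)"
proof -
  interpret vec_space "TYPE(real)" n .
  have cols: "set (cols A) \<subseteq> carrier_vec n" using cols_dim A by blast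
  obtain U where U: "finite U" "maximal U (\<lambda>T. T \<subseteq> set (cols A) \<and> lin_indpt T)"
  proof -
    have "lin_indpt {}" by (auto simp: lin_dep_def)
    then show ?thesis
      using that maximal_exists_superset[of "set (cols A)" "\<lambda>T. T \<subseteq> set (cols A) \<and> lin_indpt T" "{}"]
      by auto
  qed
  have Us: "U \<subseteq> set (cols A)" "lin_indpt U" using U(2) unfolding maximal_def by auto
  have Uc: "U \<subseteq> carrier_vec n" using Us cols by auto
  have rank: "mat_rank A = card U"
    using rank_card_indpt[OF A U(2)] A by (simp add: mat_rank_def)
  have "\<exists>a. v = lincomb a U" if v: "v \<in> set (cols A)" for v
  proof -
    have "v \<in> span U"
    proof (rule ccontr)
      assume nv: "v \<notin> span U"
      have vc: "v \<in> carrier_vec n" using v cols by auto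
      have "v \<notin> U" using nv Uc span_mem by auto
      have "lin_indpt (U \<union> {v})"
        using lin_dep_iff_in_span[of U v] Uc Us(2) vc \<open>v \<notin> U\<close> nv by auto
      then have "U \<union> {v} = U" using U(2) v Us(1) unfolding maximal_def by auto
      then show False using \<open>v \<notin> U\<close> by auto
    qed
    then show ?thesis using finite_in_span[OF U(1)] Uc by auto
  qed
  then obtain a where a: "\<And>v. v \<in> set (cols A) \<Longrightarrow> v = lincomb (a v) U" by metis
  obtain vs where vs: "set vs = U" "distinct vs" using finite_distinct_list[OF U(1)] by blast
  let ?uvs = "map (\<lambda>v. (\<lambda>x. if x < n then v $ x else 0, \<lambda>y. if y < m then a (col A y) v else 0)) vs"
  have "(if x < n \<and> y < m then A $$ (x, y) else 0) = (\<Sum>(u, v)\<leftarrow>?uvs. u x * v y)" for x y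
  proof (cases "x < n \<and> y < m")
    case True
    have "col A y \<in> set (cols A)" using True A by (metis carrier_matD(2) cols_length cols_nth nth_mem)
    then have "col A y $ x = lincomb (a (col A y)) U $ x" using a by metis
    also have "\<dots> = (\<Sum>v\<in>U. a (col A y) v * v $ x)" using True Uc by (intro lincomb_index) auto
    also have "\<dots> = (\<Sum>v\<leftarrow>vs. a (col A y) v * v $ x)"
      using vs by (simp add: sum_list_distinct_conv_sum_set)
    finally show ?thesis using True A by (simp add: comp_def mult.commute)
  qed (auto simp: comp_def)
  moreover have "length ?uvs \<le> mat_rank A" using vs rank distinct_card by fastforce
  ultimately show ?thesis unfolding factorable_def by blast
qed

lemma mat_rank_le:
  assumes "factorable r X"
  shows "mat_rank (mat n m (\<lambda>(x, y). X x y)) \<le> r"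
proof -
  interpret vec_space "TYPE(real)" n .
  have "rank (mat n m (\<lambda>(x, y). \<Sum>(u, v)\<leftarrow>uvs. u x * v y)) \<le> length uvs"
    for uvs :: "((nat \<Rightarrow> real) \<times> (nat \<Rightarrow> real)) list"
  proof (induction uvs)
    case Nil
    have "mat n m (\<lambda>_. 0 :: real) = 0\<^sub>m n m" by (rule eq_matI) auto
    then show ?case by (simp add: rank_0I)
  next
    case (Cons p uvs)
    obtain u v where p: "p = (u, v)" by force
    let ?B = "mat n m (\<lambda>(x, y). u x * v y)"
    let ?C = "mat n m (\<lambda>(x, y). \<Sum>(u, v)\<leftarrow>uvs. u x * v y)"
    have "mat n m (\<lambda>(x, y). \<Sum>(u, v)\<leftarrow>p # uvs. u x * v y) = ?B + ?C"
      by (rule eq_matI) (auto simp: p)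
    moreover have "rank (?B + ?C) \<le> rank ?B + rank ?C" by (rule rank_subadditive) auto
    moreover have "rank ?B \<le> 1" by (rule rank_le_1_product_entries[of _ m u v]) auto
    ultimately show ?case using Cons.IH by simp
  qed
  moreover obtain uvs where "length uvs \<le> r" "\<forall>x y. X x y = (\<Sum>(u, v)\<leftarrow>uvs. u x * v y)"
    using assms unfolding factorable_def by blast
  ultimately show ?thesis by (auto simp: mat_rank_def intro: order_trans)
qed

subsection \<open>Mixtures of bounded low-rank matrices\<close>

text \<open>\<open>W\<close> bounds the binary logarithm of the rank of each summand and
  \<open>M\<close> the total mass of the coefficients; products add the former and multiply the
  latter. The number of summands is left free, because sparsification depends on \<open>M\<close>
  only. Coefficients are complex to accommodate exponentials.\<close>

definition mixture :: "nat \<Rightarrow> real \<Rightarrow> (nat \<Rightarrow> nat \<Rightarrow> complex) \<Rightarrow> bool" where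
  "mixture W M f \<longleftrightarrow> (\<exists>cs.
     (\<forall>(c, X)\<in>set cs. factorable (2 ^ W) X \<and> (\<forall>x y. \<bar>X x y\<bar> \<le> 1)) \<and>
     (\<Sum>(c, X)\<leftarrow>cs. norm c) \<le> M \<and>
     (\<forall>x y. f x y = (\<Sum>(c, X)\<leftarrow>cs. c * complex_of_real (X x y))))"

lemma mixture_cmult_real:
  assumes "factorable (2 ^ W) X" "\<And>x y. \<bar>X x y\<bar> \<le> 1" "norm c \<le> M"
  shows "mixture W M (\<lambda>x y. c * complex_of_real (X x y))"
  unfolding mixture_def using assms by (intro exI[of _ "[(c, X)]"]) auto

lemma mixture_const: "norm c \<le> M \<Longrightarrow> mixture W M (\<lambda>x y. c)"
  using mixture_cmult_real[of W "\<lambda>x y. 1" c M] by (simp add: factorable_const)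

lemma mixture_mono:
  assumes "mixture V L f" "V \<le> W" "L \<le> M"
  shows "mixture W M f"
proof -
  have "(2::nat) ^ V \<le> 2 ^ W" using assms(2) by simp
  then have "factorable (2 ^ V) X \<Longrightarrow> factorable (2 ^ W) X" for X by (rule factorable_mono[rotated])
  then show ?thesis using assms unfolding mixture_def by fastforce
qed

lemma mixture_add:
  assumes "mixture W L f" "mixture W M g"
  shows "mixture W (L + M) (\<lambda>x y. f x y + g x y)"
proof -
  obtain cs ds where
    cs: "\<forall>(c, X)\<in>set cs. factorable (2 ^ W) X \<and> (\<forall>x y. \<bar>X x y\<bar> \<le> 1)"
      "(\<Sum>(c, X)\<leftarrow>cs. norm c) \<le> L"
      "\<forall>x y. f x y = (\<Sum>(c, X)\<leftarrow>cs. c * complex_of_real (X x y))" and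
    ds: "\<forall>(c, X)\<in>set ds. factorable (2 ^ W) X \<and> (\<forall>x y. \<bar>X x y\<bar> \<le> 1)"
      "(\<Sum>(c, X)\<leftarrow>ds. norm c) \<le> M"
      "\<forall>x y. g x y = (\<Sum>(c, X)\<leftarrow>ds. c * complex_of_real (X x y))"
    using assms unfolding mixture_def by blast
  then show ?thesis unfolding mixture_def by (intro exI[of _ "cs @ ds"]) auto
qed

lemma mixture_sum:
  assumes "finite I" "\<And>i. i \<in> I \<Longrightarrow> mixture W (M i) (f i)"
  shows "mixture W (\<Sum>i\<in>I. M i) (\<lambda>x y. \<Sum>i\<in>I. f i x y)"
  using assms
proof (induction I rule: finite_induct)
  case (insert i I)
  then show ?case using mixture_add[of W "M i" "f i"] by simp
qed (simp add: mixture_const)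

lemma sum_list_norm_nonneg: "0 \<le> (\<Sum>(c, X)\<leftarrow>cs. norm c)"
  by (induction cs) auto

lemma mixture_mass_nonneg: "mixture W M f \<Longrightarrow> 0 \<le> M"
  unfolding mixture_def using sum_list_norm_nonneg order_trans by blast

lemma mixture_norm_le:
  assumes "mixture W M f"
  shows "norm (f x y) \<le> M"
proof -
  obtain cs where
    cs: "\<forall>(c, X)\<in>set cs. factorable (2 ^ W) X \<and> (\<forall>x y. \<bar>X x y\<bar> \<le> 1)"
      "(\<Sum>(c, X)\<leftarrow>cs. norm c) \<le> M"
      "\<forall>x y. f x y = (\<Sum>(c, X)\<leftarrow>cs. c * complex_of_real (X x y))"
    using assms unfolding mixture_def by blast
  have "norm (\<Sum>(c, X)\<leftarrow>cs. c * complex_of_real (X x y)) \<le> (\<Sum>(c, X)\<leftarrow>cs. norm c)"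
    using cs(1)
  proof (induction cs)
    case (Cons p cs)
    obtain c X where [simp]: "p = (c, X)" by force
    have "norm (c * complex_of_real (X x y)) \<le> norm c"
      using Cons.prems by (simp add: norm_mult mult_left_le)
    then show ?case using Cons by (auto intro: norm_triangle_le add_mono)
  qed simp
  then show ?thesis using cs by auto
qed

lemma mixture_mult:
  assumes "mixture V L f" "mixture W M g"
  shows "mixture (V + W) (L * M) (\<lambda>x y. f x y * g x y)"
proof -
  obtain cs ds where
    cs: "\<forall>(c, X)\<in>set cs. factorable (2 ^ V) X \<and> (\<forall>x y. \<bar>X x y\<bar> \<le> 1)"
      "(\<Sum>(c, X)\<leftarrow>cs. norm c) \<le> L"
      "\<forall>x y. f x y = (\<Sum>(c, X)\<leftarrow>cs. c * complex_of_real (X x y))" and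
    ds: "\<forall>(c, X)\<in>set ds. factorable (2 ^ W) X \<and> (\<forall>x y. \<bar>X x y\<bar> \<le> 1)"
      "(\<Sum>(c, X)\<leftarrow>ds. norm c) \<le> M"
      "\<forall>x y. g x y = (\<Sum>(c, X)\<leftarrow>ds. c * complex_of_real (X x y))"
    using assms unfolding mixture_def by blast
  let ?es = "map (\<lambda>((c, X), (d, Y)). (c * d, \<lambda>x y. X x y * Y x y)) (List.product cs ds)"
  have "\<forall>(c, X)\<in>set ?es. factorable (2 ^ (V + W)) X \<and> (\<forall>x y. \<bar>X x y\<bar> \<le> 1)"
    using cs(1) ds(1) by (fastforce simp: power_add abs_mult intro: factorable_mult mult_le_one)
  moreover have "(\<Sum>(c, X)\<leftarrow>?es. norm c) \<le> L * M"
  proof -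
    have "(\<Sum>(c, X)\<leftarrow>?es. norm c) = (\<Sum>(c, X)\<leftarrow>cs. norm c) * (\<Sum>(c, X)\<leftarrow>ds. norm c)"
      by (simp add: sum_list_product comp_def case_prod_beta norm_mult)
    also have "\<dots> \<le> L * M"
      using cs(2) ds(2) sum_list_norm_nonneg mixture_mass_nonneg[OF assms(1)] by (intro mult_mono) auto
    finally show ?thesis .
  qed
  moreover have "f x y * g x y = (\<Sum>(c, X)\<leftarrow>?es. c * complex_of_real (X x y))" for x y
    using cs(3) ds(3) by (simp add: sum_list_product comp_def case_prod_beta mult_ac)
  ultimately show ?thesis unfolding mixture_def by blast
qed

lemma mixture_cmult: "mixture W M f \<Longrightarrow> mixture W (norm c * M) (\<lambda>x y. c * f x y)"
  using mixture_mult[of 0 "norm c" "\<lambda>x y. c" W M f] by (simp add: mixture_const)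

lemma mixture_power: "mixture W M f \<Longrightarrow> mixture (k * W) (M ^ k) (\<lambda>x y. f x y ^ k)"
proof (induction k)
  case (Suc k)
  then show ?case using mixture_mult[of W M f "k * W" "M ^ k"] by (simp add: add.commute)
qed (simp add: mixture_const)

lemma mixture_prod:
  assumes "finite I" "\<And>i. i \<in> I \<Longrightarrow> mixture (W i) (M i) (f i)"
  shows "mixture (\<Sum>i\<in>I. W i) (\<Prod>i\<in>I. M i) (\<lambda>x y. \<Prod>i\<in>I. f i x y)"
  using assms
proof (induction I rule: finite_induct)
  case (insert i I)
  then show ?case using mixture_mult[of "W i" "M i" "f i"] by simp
qed (simp add: mixture_const)

text \<open>The matrices are real, so the imaginary part can be taken in the coefficients, whose
  norms do not grow.\<close>

lemma mixture_Im:
  assumes "mixture W M f"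
  shows "mixture W M (\<lambda>x y. complex_of_real (Im (f x y)))"
proof -
  obtain cs where
    cs: "\<forall>(c, X)\<in>set cs. factorable (2 ^ W) X \<and> (\<forall>x y. \<bar>X x y\<bar> \<le> 1)"
      "(\<Sum>(c, X)\<leftarrow>cs. norm c) \<le> M"
      "\<forall>x y. f x y = (\<Sum>(c, X)\<leftarrow>cs. c * complex_of_real (X x y))"
    using assms unfolding mixture_def by blast
  let ?ds = "map (\<lambda>(c, X). (complex_of_real (Im c), X)) cs"
  have "(\<Sum>(c, X)\<leftarrow>?ds. norm c) \<le> (\<Sum>(c, X)\<leftarrow>cs. norm c)"
    by (simp add: comp_def case_prod_beta sum_list_mono abs_Im_le_cmod)
  moreover have "complex_of_real (Im (\<Sum>(c, X)\<leftarrow>cs. c * complex_of_real (X x y))) =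
      (\<Sum>(c, X)\<leftarrow>?ds. c * complex_of_real (X x y))" for x y
    by (induction cs) auto
  ultimately show ?thesis unfolding mixture_def using cs
    by (intro exI[of _ ?ds]) auto
qed

text \<open>The rank cost is governed by the highest power, whereas the masses add up to a partial
  sum of the series of \<open>exp (norm t * M)\<close>.\<close>

lemma mixture_exp_partial:
  assumes "mixture W M f"
  shows "mixture (K * W) (exp (norm t * M)) (\<lambda>x y. \<Sum>k<K. (t * f x y) ^ k / fact k)"
proof -
  have M: "0 \<le> M" using mixture_mass_nonneg assms .
  have "mixture (K * W) (\<Sum>k<K. (norm t * M) ^ k / fact k) (\<lambda>x y. \<Sum>k<K. (t * f x y) ^ k / fact k)"
  proof (rule mixture_sum)
    fix k assume "k \<in> {..<K}"
    then have "k * W \<le> K * W" by simp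
    then have "mixture (K * W) (norm (inverse (fact k) :: complex) * (norm t * M) ^ k)
        (\<lambda>x y. inverse (fact k) * (t * f x y) ^ k)"
      by (intro mixture_mono[OF mixture_cmult[OF mixture_power[OF mixture_cmult[OF assms]]]]) auto
    then show "mixture (K * W) ((norm t * M) ^ k / fact k) (\<lambda>x y. (t * f x y) ^ k / fact k)"
      by (simp add: norm_inverse divide_inverse mult.commute)
  qed simp
  moreover have "(\<Sum>k<K. (norm t * M) ^ k / fact k) \<le> exp (norm t * M)"
    using sum_le_suminf[of "\<lambda>k. (norm t * M) ^ k / fact k" "{..<K}"] M exp_converges[of "norm t * M"]
    by (simp add: exp_def scaleR_conv_of_real divide_inverse mult.commute sums_iff)
  ultimately show ?thesis by (blast intro: mixture_mono)
qed

text \<open>Choosing summands one by one by multiplicative weights replaces a random sample, so that the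
  number of summands grows only logarithmically with the number of entries.\<close>

lemma mixture_sparsify:
  assumes f: "mixture W M f"
    and E: "finite (E :: (nat \<times> nat) set)" "E \<noteq> {}"
    and e: "0 < e" "e \<le> 4 * M"
    and N: "0 < N" "16 * M\<^sup>2 * ln (2 * card E) \<le> e\<^sup>2 * real N"
  shows "\<exists>Z. factorable (N * 2 ^ W) Z \<and> (\<forall>(x, y)\<in>E. \<bar>Z x y - Re (f x y)\<bar> \<le> e)"
proof -
  have M: "0 < M" using e by simp
  obtain cs where
    cs: "\<forall>(c, X)\<in>set cs. factorable (2 ^ W) X \<and> (\<forall>x y. \<bar>X x y\<bar> \<le> 1)"
      "(\<Sum>(c, X)\<leftarrow>cs. norm c) \<le> M"
      "\<forall>x y. f x y = (\<Sum>(c, X)\<leftarrow>cs. c * complex_of_real (X x y))"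
    using f unfolding mixture_def by blast
  define g where "g x y = Re (f x y)" for x y
  have g: "g x y = (\<Sum>(c, X)\<leftarrow>cs. Re c * X x y)" for x y
  proof -
    have "Re (\<Sum>(c, X)\<leftarrow>cs. c * complex_of_real (X x y)) = (\<Sum>(c, X)\<leftarrow>cs. Re c * X x y)"
      by (induction cs) auto
    then show ?thesis using cs(3) by (simp add: g_def)
  qed
  have g_le: "\<bar>g x y\<bar> \<le> M" for x y
    using mixture_norm_le[OF f, of x y] abs_Re_le_cmod[of "f x y"] by (simp add: g_def)
  define S where "S = {V. factorable (2 ^ W) V \<and> (\<forall>x y. \<bar>V x y\<bar> \<le> M)}"
  \<comment> \<open>The Boolean selects one side of the two-sided error, so that one-sided
    guarantees suffice; \<open>2 * M\<close> bounds the difference and normalizes the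
    values.\<close>
  define val where "val V p = (case p of ((x, y), b) \<Rightarrow>
     (if b then 1 else -1) * (V x y - g x y) / (2 * M))" for V and p :: "(nat \<times> nat) \<times> bool"
  \<comment> \<open>A loss of \<open>2 * l\<close> per round, in units of \<open>2 * M\<close>, is
    an error of exactly \<open>e\<close>.\<close>
  define l where "l = e / (4 * M)"
  have l: "0 < l" "l \<le> 1" using e M by (auto simp: l_def)
  have "\<exists>a. (\<forall>i<N. a i \<in> S) \<and>
      (\<forall>p\<in>E \<times> UNIV. real N * (0 - 2 * l) \<le> (\<Sum>i<N. val (a i) p))"
  proof (rule multiplicative_weights)
    show "finite (E \<times> (UNIV :: bool set))" using E by auto
    show "E \<times> (UNIV :: bool set) \<noteq> {}" using E by auto
    show "0 < l" "l \<le> 1" by fact+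
    show "ln (card (E \<times> (UNIV :: bool set))) \<le> l\<^sup>2 * real N"
      using N M by (simp add: card_cartesian_product l_def field_simps power2_eq_square)
  next
    fix V and p :: "(nat \<times> nat) \<times> bool" assume V: "V \<in> S"
    obtain x y b where [simp]: "p = ((x, y), b)" by (cases p) auto
    have "\<bar>V x y\<bar> \<le> M" using V by (simp add: S_def)
    then have "\<bar>V x y - g x y\<bar> \<le> 2 * M"
      using g_le[of x y] abs_triangle_ineq4[of "V x y" "g x y"] by linarith
    then show "\<bar>val V p\<bar> \<le> 1" using M by (simp add: val_def abs_mult)
  next
    fix w :: "(nat \<times> nat) \<times> bool \<Rightarrow> real"
    \<comment> \<open>The weights of the two signs merge into a signed weight. A response of value
      at least 0 is then a matrix on which the linear functional \<open>phi\<close> is at least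
      \<open>phi g\<close>.\<close>
    define q where "q p = w (p, True) - w (p, False)" for p
    define phi where "phi V = (\<Sum>(x, y)\<in>E. q (x, y) * V x y)" for V :: "nat \<Rightarrow> nat \<Rightarrow> real"
    have phi_cmult: "phi (\<lambda>x y. c * V x y) = c * phi V" for c V
      by (simp add: phi_def sum_distrib_left case_prod_beta mult_ac)
    \<comment> \<open>Best response: the summand with the largest \<open>\<bar>phi X\<bar>\<close>,
      given the favourable sign and scaled to size \<open>M\<close>. Since \<open>g\<close> has
      total mass at most \<open>M\<close>, it cannot do better.\<close>
    have "\<exists>V\<in>S. \<forall>X\<in>snd ` set cs. M * \<bar>phi X\<bar> \<le> phi V"
      using cs(1)
    proof (induction cs)
      case Nil
      then show ?case using M by (intro bexI[of _ "\<lambda>x y. 0"]) (auto simp: S_def factorable_0)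
    next
      case (Cons p cs)
      then obtain V where V: "V \<in> S" "\<forall>X\<in>snd ` set cs. M * \<bar>phi X\<bar> \<le> phi V" by auto
      let ?X = "snd p"
      let ?U = "\<lambda>x y. (M * sgn (phi ?X)) * ?X x y"
      have X: "factorable (2 ^ W) ?X" "\<And>x y. \<bar>?X x y\<bar> \<le> 1" using Cons.prems by (auto simp: case_prod_beta)
      have "\<bar>?U x y\<bar> \<le> M" for x y
      proof -
        have "\<bar>?U x y\<bar> = M * (\<bar>sgn (phi ?X)\<bar> * \<bar>?X x y\<bar>)" using M by (simp add: abs_mult)
        also have "\<dots> \<le> M * (1 * 1)" using X(2) M
          by (intro mult_left_mono mult_mono) (auto simp: sgn_if)
        finally show ?thesis by simp
      qed
      then have U: "?U \<in> S" using factorable_cmult[OF X(1)] by (simp add: S_def)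
      have "phi ?U = M * \<bar>phi ?X\<bar>" by (subst phi_cmult) (simp add: sgn_if)
      then show ?case
        using U V by (cases "phi V \<le> phi ?U") (force intro: bexI[of _ ?U] bexI[of _ V])+
    qed
    then obtain V where V: "V \<in> S" "\<And>c X. (c, X) \<in> set cs \<Longrightarrow> M * \<bar>phi X\<bar> \<le> phi V" by force
    \<comment> \<open>For an empty list the property of \<open>V\<close> is void; then
      \<open>g\<close> is 0 and the zero matrix is the response.\<close>
    have "phi g \<le> phi V \<or> cs = []"
    proof (cases "cs = []")
      case False
      then obtain c0 X0 where "(c0, X0) \<in> set cs" by (metis list.set_intros(1) neq_Nil_conv surj_pair)
      then have V0: "0 \<le> phi V" using V(2)[of c0 X0] M by (meson abs_ge_zero mult_nonneg_nonneg less_imp_le order_trans)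
      have "phi g = (\<Sum>(c, X)\<leftarrow>cs. Re c * phi X)"
      proof -
        have "phi (\<lambda>x y. \<Sum>(c, X)\<leftarrow>cs. Re c * X x y) = (\<Sum>(c, X)\<leftarrow>cs. Re c * phi X)"
          by (induction cs) (auto simp: phi_def case_prod_beta distrib_left sum.distrib sum_distrib_left mult_ac)
        then show ?thesis using g by (simp add: phi_def)
      qed
      also have "\<dots> \<le> (\<Sum>(c, X)\<leftarrow>cs. norm c * (phi V / M))"
      proof (rule sum_list_mono)
        fix p assume p: "p \<in> set cs"
        obtain c X where [simp]: "p = (c, X)" by force
        have "Re c * phi X \<le> \<bar>Re c\<bar> * \<bar>phi X\<bar>" by (metis abs_ge_self abs_mult)
        also have "\<dots> \<le> norm c * (phi V / M)"
          using V(2)[of c X] p M abs_Re_le_cmod by (intro mult_mono) (auto simp: field_simps)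
        finally show "(case p of (c, X) \<Rightarrow> Re c * phi X) \<le> (case p of (c, X) \<Rightarrow> norm c * (phi V / M))"
          by simp
      qed
      also have "\<dots> = (\<Sum>(c, X)\<leftarrow>cs. norm c) * (phi V / M)"
        by (induction cs) (simp_all add: case_prod_beta distrib_right add_divide_distrib)
      also have "\<dots> \<le> M * (phi V / M)" using cs(2) V0 M by (intro mult_right_mono) auto
      finally show ?thesis using M by simp
    qed simp
    moreover have "phi g \<le> phi (\<lambda>x y. 0)" if "cs = []"
      using that g by (simp add: phi_def)
    moreover have "(\<lambda>x y. 0) \<in> S" using M by (simp add: S_def factorable_0)
    ultimately obtain U where U: "U \<in> S" "phi g \<le> phi U" using V(1) by blast
    have "(\<Sum>p\<in>E \<times> UNIV. w p * val U p) = (\<Sum>p\<in>E. \<Sum>b\<in>UNIV. w (p, b) * val U (p, b))"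
      by (simp add: sum.cartesian_product)
    also have "\<dots> = (\<Sum>p\<in>E. q p * (U (fst p) (snd p) - g (fst p) (snd p)) / (2 * M))"
      by (intro sum.cong) (auto simp: UNIV_bool val_def q_def algebra_simps add_divide_distrib diff_divide_distrib)
    also have "\<dots> = (phi U - phi g) / (2 * M)"
      by (simp add: phi_def case_prod_beta sum_subtractf right_diff_distrib sum_divide_distrib[symmetric])
    finally have "(\<Sum>p\<in>E \<times> UNIV. w p * val U p) \<ge> 0" using U M by simp
    then show "\<exists>a\<in>S. 0 * sum w (E \<times> UNIV) \<le> (\<Sum>e\<in>E \<times> UNIV. w e * val a e)" using U by auto
  qed
  then obtain a where a: "\<And>i. i < N \<Longrightarrow> a i \<in> S"
    "\<And>p. p \<in> E \<times> UNIV \<Longrightarrow> - (real N * (2 * l)) \<le> (\<Sum>i<N. val (a i) p)" by auto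
  define Z where "Z x y = (1 / real N) * (\<Sum>i<N. a i x y)" for x y
  have "factorable (N * 2 ^ W) Z"
    unfolding Z_def using factorable_sum[of "{..<N}" "2 ^ W" a] a(1)
    by (intro factorable_cmult) (auto simp: S_def)
  moreover have "\<bar>Z x y - g x y\<bar> \<le> e" if xy: "(x, y) \<in> E" for x y
  proof -
    have s: "(\<Sum>i<N. val (a i) ((x, y), b)) = (if b then 1 else -1) * real N * (Z x y - g x y) / (2 * M)" for b
      using N M by (simp add: val_def Z_def sum_divide_distrib[symmetric] sum_subtractf sum_negf field_simps)
    have "real N * (Z x y - g x y) \<ge> - (real N * e)" "- (real N * (Z x y - g x y)) \<ge> - (real N * e)"
      using a(2)[of "((x, y), True)"] a(2)[of "((x, y), False)"] xy M
      by (auto simp: s l_def field_simps)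
    then have "real N * (Z x y - g x y) \<ge> real N * (- e)" "real N * (Z x y - g x y) \<le> real N * e" by auto
    then have "- e \<le> Z x y - g x y" "Z x y - g x y \<le> e"
      using N(1) by (simp_all only: mult_le_cancel_left_pos of_nat_0_less_iff)
    then show ?thesis by simp
  qed
  ultimately show ?thesis unfolding g_def by blast
qed

subsection \<open>Truncated exponentials\<close>

text \<open>In the tail, indices are at least \<open>K\<close>, so multiplying a term by
  \<open>exp (- K)\<close> and that power of 3 does not decrease it. The enlarged terms belong to
  the series of \<open>exp (3 * x)\<close>.\<close>

lemma norm_exp_minus_partial_le:
  fixes z :: complex
  assumes "norm z \<le> x"
  shows "norm (exp z - (\<Sum>k<K. z ^ k / fact k)) \<le> exp (3 * x - real K)"
proof -
  have x: "0 \<le> x" using assms norm_ge_zero order_trans by blast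
  have z: "(\<lambda>k. z ^ k / fact k) sums exp z"
    using exp_converges[of z] by (simp add: scaleR_conv_of_real divide_inverse mult.commute)
  have "(\<lambda>k. z ^ (k + K) / fact (k + K)) sums (exp z - (\<Sum>k<K. z ^ k / fact k))"
    using sums_iff_shift[of "\<lambda>k. z ^ k / fact k" K] z by simp
  then have eq: "exp z - (\<Sum>k<K. z ^ k / fact k) = (\<Sum>k. z ^ (k + K) / fact (k + K))"
    by (simp add: sums_iff)
  define g where "g k = exp (- real K) * ((3 * x) ^ k / fact k)" for k
  have "(\<lambda>k. (3 * x) ^ k / fact k) sums exp (3 * x)"
    using exp_converges[of "3 * x"] by (simp add: divide_inverse mult.commute)
  then have g: "g sums (exp (- real K) * exp (3 * x))"
    unfolding g_def by (rule sums_mult)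
  have gK: "(\<lambda>k. g (k + K)) sums (exp (- real K) * exp (3 * x) - (\<Sum>k<K. g k))"
    using sums_iff_shift[of g K] g by simp
  have "norm (\<Sum>k. z ^ (k + K) / fact (k + K)) \<le> (\<Sum>k. g (k + K))"
  proof (rule norm_suminf_le)
    fix k
    have "exp 1 ^ K \<le> (3::real) ^ K" using exp_le by (intro power_mono) auto
    also have "\<dots> \<le> 3 ^ (k + K)" by (intro power_increasing) auto
    finally have "exp (real K) \<le> 3 ^ (k + K)" by (simp add: exp_of_nat_mult[symmetric])
    then have c: "1 \<le> exp (- real K) * 3 ^ (k + K)" by (simp add: exp_minus field_simps)
    have "norm (z ^ (k + K) / fact (k + K)) \<le> x ^ (k + K) / fact (k + K)"
      using assms by (simp add: norm_divide norm_power divide_right_mono power_mono)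
    also have "\<dots> \<le> (exp (- real K) * 3 ^ (k + K)) * (x ^ (k + K) / fact (k + K))"
      using mult_right_mono[OF c, of "x ^ (k + K) / fact (k + K)"] x by simp
    also have "\<dots> = g (k + K)" by (simp add: g_def power_mult_distrib)
    finally show "norm (z ^ (k + K) / fact (k + K)) \<le> g (k + K)" .
  next
    show "summable (\<lambda>k. g (k + K))" using gK by (rule sums_summable)
  qed
  also have "\<dots> = exp (- real K) * exp (3 * x) - (\<Sum>k<K. g k)" using gK by (simp add: sums_iff)
  also have "\<dots> \<le> exp (- real K) * exp (3 * x)"
    using x by (simp add: g_def sum_nonneg)
  also have "\<dots> = exp (3 * x - real K)" by (simp add: exp_add[symmetric])
  finally show ?thesis using eq by simp
qed

text \<open>Telescoping one factor at a time. Only the exact factors have norm at most 1; the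
  approximate product is bounded through its distance from the exact one.\<close>

lemma norm_prod_diff_le_power:
  fixes a b :: "'i \<Rightarrow> complex"
  assumes "finite I" "\<And>i. i \<in> I \<Longrightarrow> norm (a i) \<le> 1" "\<And>i. i \<in> I \<Longrightarrow> norm (a i - b i) \<le> e" "0 \<le> e"
  shows "norm ((\<Prod>i\<in>I. a i) - (\<Prod>i\<in>I. b i)) \<le> (1 + e) ^ card I - 1"
  using assms(1-3)
proof (induction I rule: finite_induct)
  case (insert i I)
  let ?A = "\<Prod>i\<in>I. a i" and ?B = "\<Prod>i\<in>I. b i"
  have IH: "norm (?A - ?B) \<le> (1 + e) ^ card I - 1" using insert by simp
  have "norm ?A \<le> 1"
    using insert.prems prod_mono[of I "\<lambda>i. norm (a i)" "\<lambda>_. 1"] by (simp add: prod_norm[symmetric])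
  then have B: "norm ?B \<le> (1 + e) ^ card I"
    using IH norm_triangle_ineq4[of ?A "?A - ?B"] by simp
  have "norm (a i * ?A - b i * ?B) = norm (a i * (?A - ?B) + (a i - b i) * ?B)"
    by (simp add: algebra_simps)
  also have "\<dots> \<le> norm (a i) * norm (?A - ?B) + norm (a i - b i) * norm ?B"
    by (metis norm_mult norm_triangle_ineq)
  also have "\<dots> \<le> 1 * ((1 + e) ^ card I - 1) + e * (1 + e) ^ card I"
    using insert.prems IH B assms(4) by (intro add_mono mult_mono) auto
  finally show ?case using insert by (simp add: algebra_simps)
qed simp

lemma sum_inverse_powers_of_two_le: "(\<Sum>i<s. 1 / 2 ^ i) \<le> (2::real)"
proof -
  have "(\<Sum>i<s. 1 / 2 ^ i) = 2 - 2 / (2::real) ^ s" by (induction s) (auto simp: field_simps)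
  then show ?thesis by simp
qed

text \<open>Factor \<open>exp (\<i> * d * (\<Sum>i<s. S i))\<close> over the scales: at scale \<open>i\<close> the exponent is only of size
  \<open>n / 2 ^ i\<close>, hence few terms of the exponential series are needed exactly where each of them is
  expensive in rank.\<close>

lemma mixture_sin_over:
  fixes S :: "nat \<Rightarrow> nat \<Rightarrow> nat \<Rightarrow> real"
  assumes S: "\<And>i. i < s \<Longrightarrow> mixture (2 ^ Suc i) (1 / 2 ^ i) (\<lambda>x y. complex_of_real (S i x y))"
    and K: "\<And>i. i < s \<Longrightarrow> 3 * real n / 2 ^ i + real q \<le> real (K i)" "1 \<le> q" "1 \<le> n"
    and d: "\<bar>d\<bar> \<le> real n" "d = 0 \<or> 1 \<le> \<bar>d\<bar>"
  shows "\<exists>h. mixture (\<Sum>i<s. K i * 2 ^ Suc i) (exp (2 * real n)) h \<and>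
     (\<forall>x y. norm (h x y - complex_of_real (sin_over d (\<Sum>i<s. S i x y))) \<le> (1 + exp (- real q)) ^ s - 1)"
proof (cases "d = 0")
  case True
  define h where "h x y = (\<Sum>i<s. complex_of_real (S i x y))" for x y
  have "mixture (\<Sum>i<s. K i * 2 ^ Suc i) (\<Sum>i<s. 1 / 2 ^ i) h"
    unfolding h_def
  proof (rule mixture_sum)
    fix i assume i: "i \<in> {..<s}"
    have "1 \<le> real q" using K(2) by simp
    also have "\<dots> \<le> 3 * real n / 2 ^ i + real q" by simp
    also have "\<dots> \<le> real (K i)" using K(1) i by simp
    finally have "1 \<le> K i" by simp
    then have "2 ^ Suc i \<le> K i * 2 ^ Suc i" by simp
    also have "\<dots> \<le> (\<Sum>i<s. K i * 2 ^ Suc i)" using i by (intro member_le_sum) auto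
    finally show "mixture (\<Sum>i<s. K i * 2 ^ Suc i) (1 / 2 ^ i) (\<lambda>x y. complex_of_real (S i x y))"
      using S[of i] i by (auto intro: mixture_mono)
  qed simp
  moreover have "(\<Sum>i<s. 1 / 2 ^ i) \<le> exp (2 * real n)"
    using sum_inverse_powers_of_two_le[of s] exp_ge_add_one_self[of "2 * real n"] K(3) by linarith
  ultimately have "mixture (\<Sum>i<s. K i * 2 ^ Suc i) (exp (2 * real n)) h" by (blast intro: mixture_mono)
  moreover have "h x y = complex_of_real (sin_over d (\<Sum>i<s. S i x y))" for x y
    using True by (simp add: h_def sin_over_def)
  ultimately show ?thesis by (intro exI[of _ h]) auto
next
  case False
  define t where "t = \<i> * complex_of_real d"
  have t: "norm t = \<bar>d\<bar>" by (simp add: t_def norm_mult)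
  define p where "p i x y = (\<Sum>k<K i. (t * complex_of_real (S i x y)) ^ k / fact k)" for i x y
  \<comment> \<open>The sine of a sum is the imaginary part of a product of exponentials, so the
    imaginary part is taken only after multiplying the scales.\<close>
  define h where "h x y = complex_of_real (1 / d) * complex_of_real (Im (\<Prod>i<s. p i x y))" for x y
  have "mixture (\<Sum>i<s. K i * 2 ^ Suc i) (\<Prod>i<s. exp (norm t * (1 / 2 ^ i))) (\<lambda>x y. \<Prod>i<s. p i x y)"
    unfolding p_def by (intro mixture_prod mixture_exp_partial S) auto
  then have "mixture (\<Sum>i<s. K i * 2 ^ Suc i) (norm (complex_of_real (1 / d)) * (\<Prod>i<s. exp (norm t * (1 / 2 ^ i)))) h"
    unfolding h_def by (intro mixture_cmult mixture_Im)
  moreover have "norm (complex_of_real (1 / d)) * (\<Prod>i<s. exp (norm t * (1 / 2 ^ i))) \<le> exp (2 * real n)"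
  proof -
    have "norm (complex_of_real (1 / d)) \<le> 1" using d False by (simp add: norm_divide field_simps)
    moreover have "(\<Prod>i<s. exp (norm t * (1 / 2 ^ i))) \<le> exp (2 * real n)"
    proof -
      \<comment> \<open>The masses of the factors multiply, and their exponents form a geometric
        series, so the total does not depend on the number of scales.\<close>
      have "norm t * (\<Sum>i<s. 1 / 2 ^ i) \<le> real n * 2"
        using sum_inverse_powers_of_two_le[of s] d(1) by (intro mult_mono) (auto simp: t sum_nonneg)
      then show ?thesis by (simp add: exp_sum[symmetric] sum_distrib_left)
    qed
    ultimately show ?thesis using mult_mono[of "norm (complex_of_real (1 / d))" 1] by (simp add: prod_nonneg)
  qed
  ultimately have "mixture (\<Sum>i<s. K i * 2 ^ Suc i) (exp (2 * real n)) h" by (blast intro: mixture_mono)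
  moreover have "norm (h x y - complex_of_real (sin_over d (\<Sum>i<s. S i x y))) \<le> (1 + exp (- real q)) ^ s - 1"
    for x y
  proof -
    define u where "u i = exp (t * complex_of_real (S i x y))" for i
    have "norm ((\<Prod>i<s. u i) - (\<Prod>i<s. p i x y)) \<le> (1 + exp (- real q)) ^ card {..<s} - 1"
    proof (rule norm_prod_diff_le_power)
      fix i assume i: "i \<in> {..<s}"
      show "norm (u i) \<le> 1" by (simp add: u_def t_def)
      \<comment> \<open>The exponent at scale \<open>i\<close> is at most \<open>n / 2 ^ i\<close>,
        so the lower bound on \<open>K i\<close> leaves a truncation error of at most
        \<open>exp (- q)\<close> in each factor.\<close>
      have "norm (complex_of_real (S i x y)) \<le> 1 / 2 ^ i" using i by (intro mixture_norm_le[OF S]) auto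
      then have "norm (t * complex_of_real (S i x y)) \<le> real n * (1 / 2 ^ i)"
        unfolding norm_mult t using d(1) by (intro mult_mono) auto
      then have "norm (u i - p i x y) \<le> exp (3 * (real n * (1 / 2 ^ i)) - real (K i))"
        unfolding u_def p_def by (rule norm_exp_minus_partial_le)
      also have "\<dots> \<le> exp (- real q)" using K(1)[of i] i by simp
      finally show "norm (u i - p i x y) \<le> exp (- real q)" .
    qed auto
    moreover have "sin (d * (\<Sum>i<s. S i x y)) = Im (\<Prod>i<s. u i)"
    proof -
      have "(\<Prod>i<s. u i) = exp (\<Sum>i<s. t * complex_of_real (S i x y))"
        by (simp add: u_def exp_sum)
      also have "\<dots> = cis (d * (\<Sum>i<s. S i x y))"
        by (simp add: t_def cis_conv_exp sum_distrib_left mult.assoc)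
      finally show ?thesis by simp
    qed
    ultimately have err: "\<bar>Im (\<Prod>i<s. p i x y) - sin (d * (\<Sum>i<s. S i x y))\<bar> \<le> (1 + exp (- real q)) ^ s - 1"
      using abs_Im_le_cmod[of "(\<Prod>i<s. p i x y) - (\<Prod>i<s. u i)"] by (simp add: norm_minus_commute)
    have "h x y - complex_of_real (sin_over d (\<Sum>i<s. S i x y)) =
        complex_of_real ((Im (\<Prod>i<s. p i x y) - sin (d * (\<Sum>i<s. S i x y))) / d)"
      using False by (simp add: h_def sin_over_def diff_divide_distrib)
    then have "norm (h x y - complex_of_real (sin_over d (\<Sum>i<s. S i x y))) =
        \<bar>Im (\<Prod>i<s. p i x y) - sin (d * (\<Sum>i<s. S i x y))\<bar> / \<bar>d\<bar>"
      by (simp only: norm_of_real abs_divide)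
    also have "\<dots> \<le> \<bar>Im (\<Prod>i<s. p i x y) - sin (d * (\<Sum>i<s. S i x y))\<bar> / 1"
      using d(2) False by (intro divide_left_mono) auto
    finally show ?thesis using err by simp
  qed
  ultimately show ?thesis by blast
qed

text \<open>\<open>h\<close> approximates 4/5 of the normalized Fejer integral up to 1/20. This
  yields 4/5 + 1/20 = 17/20 everywhere and 4/5 * 2/3 - 1/20 = 29/60 beyond the margin
  \<open>d\<close>, which leaves room for a later sampling error of 1/10 on both sides.\<close>

lemma mixture_sign:
  fixes S :: "nat \<Rightarrow> nat \<Rightarrow> nat \<Rightarrow> real"
  assumes S: "\<And>i. i < s \<Longrightarrow> mixture (2 ^ Suc i) (1 / 2 ^ i) (\<lambda>x y. complex_of_real (S i x y))"
    and K: "\<And>i. i < s \<Longrightarrow> 3 * real n / 2 ^ i + real q \<le> real (K i)" "1 \<le> q" "1 \<le> n"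
    and q: "real n * ((1 + exp (- real q)) ^ s - 1) \<le> 1 / 32"
    and bounded: "\<And>x y. \<bar>\<Sum>i<s. S i x y\<bar> \<le> 1"
    and d: "0 < d" "64 \<le> real n * d"
  shows "\<exists>h. mixture (\<Sum>i<s. K i * 2 ^ Suc i) (2 * real n * exp (2 * real n)) h \<and>
     (\<forall>x y. \<bar>Re (h x y)\<bar> \<le> 17 / 20 \<and>
        (d \<le> (\<Sum>i<s. S i x y) \<longrightarrow> 29 / 60 \<le> Re (h x y)) \<and>
        ((\<Sum>i<s. S i x y) \<le> - d \<longrightarrow> Re (h x y) \<le> - 29 / 60))"
proof -
  define R where "R x y = (\<Sum>i<s. S i x y)" for x y
  define e where "e = (1 + exp (- real q)) ^ s - 1"
  define W where "W = (\<Sum>i<s. K i * 2 ^ Suc i)"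
  have "\<exists>h. mixture W (exp (2 * real n)) h \<and>
      (\<forall>x y. norm (h x y - complex_of_real (sin_over (real j - real k) (R x y))) \<le> e)"
    if "j < n" "k < n" for j k
    unfolding W_def e_def R_def using that by (intro mixture_sin_over[OF S K]) auto
  then obtain g where g: "\<And>j k. j < n \<Longrightarrow> k < n \<Longrightarrow> mixture W (exp (2 * real n)) (g j k)"
    "\<And>j k x y. j < n \<Longrightarrow> k < n \<Longrightarrow> norm (g j k x y - complex_of_real (sin_over (real j - real k) (R x y))) \<le> e"
    by metis
  define G where "G = fejer_integral n 1"
  have G: "1 / 2 \<le> G" unfolding G_def using K(3) by (intro fejer_integral_ge_half) simp
  \<comment> \<open>Since \<open>G\<close> is at least 1/2, \<open>n * a\<close> is at most 8/5. The
    \<open>n\<^sup>2\<close> summands, each with error \<open>e\<close>, thus contribute at most 8/5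
    * 1/32 = 1/20.\<close>
  define a where "a = 4 / 5 / (real n * G)"
  have a: "0 \<le> a" using G by (simp add: a_def)
  have na: "real n * a \<le> 8 / 5" using G K(3) by (simp add: a_def field_simps)
  define h where "h x y = complex_of_real a * (\<Sum>j<n. \<Sum>k<n. g j k x y)" for x y
  have "mixture W (norm (complex_of_real a) * (\<Sum>j<n. \<Sum>k<n. exp (2 * real n))) h"
    unfolding h_def using g(1) by (intro mixture_cmult mixture_sum) auto
  moreover have "norm (complex_of_real a) * (\<Sum>j<n. \<Sum>k<n. exp (2 * real n)) \<le> 2 * real n * exp (2 * real n)"
  proof -
    have "norm (complex_of_real a) * (\<Sum>j<n. \<Sum>k<n. exp (2 * real n)) =
        (real n * a) * (real n * exp (2 * real n))" using a by simp
    also have "\<dots> \<le> 2 * (real n * exp (2 * real n))" using na by (intro mult_right_mono) auto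
    finally show ?thesis by simp
  qed
  ultimately have h: "mixture W (2 * real n * exp (2 * real n)) h" by (blast intro: mixture_mono)
  have err: "\<bar>Re (h x y) - 4 / 5 * (fejer_integral n (R x y) / G)\<bar> \<le> 1 / 20" for x y
  proof -
    have "4 / 5 * (fejer_integral n (R x y) / G) = a * (\<Sum>j<n. \<Sum>k<n. sin_over (real j - real k) (R x y))"
      using K(3) G by (simp add: a_def fejer_integral_def)
    then have "Re (h x y) - 4 / 5 * (fejer_integral n (R x y) / G) =
        a * Re (\<Sum>j<n. \<Sum>k<n. g j k x y - complex_of_real (sin_over (real j - real k) (R x y)))"
      by (simp add: h_def sum_subtractf right_diff_distrib)
    also have "\<bar>\<dots>\<bar> \<le> a * norm (\<Sum>j<n. \<Sum>k<n. g j k x y - complex_of_real (sin_over (real j - real k) (R x y)))"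
      using a by (simp only: abs_mult abs_of_nonneg) (intro mult_left_mono abs_Re_le_cmod)
    also have "\<dots> \<le> a * (\<Sum>j<n. \<Sum>k<n. e)"
      using a g(2) by (intro mult_left_mono sum_norm_le) auto
    also have "\<dots> = (real n * a) * (real n * e)" by simp
    also have "\<dots> \<le> 8 / 5 * (1 / 32)"
      using na q a by (intro mult_mono) (auto simp: e_def)
    finally show ?thesis by simp
  qed
  have "\<bar>Re (h x y)\<bar> \<le> 17 / 20" for x y
  proof -
    have "\<bar>fejer_integral n (R x y) / G\<bar> \<le> 1"
      using abs_fejer_integral_le[OF bounded, of n x y] G by (simp add: R_def G_def)
    then show ?thesis using err[of x y] by linarith
  qed
  moreover have "29 / 60 \<le> Re (h x y)" if "d \<le> R x y" for x y
  proof -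
    have "2 / 3 * G \<le> fejer_integral n (R x y)" unfolding G_def
      using that d bounded[of x y] by (intro fejer_integral_step[of n d]) (auto simp: R_def)
    then have "2 / 3 \<le> fejer_integral n (R x y) / G" using G by (simp add: field_simps)
    then show ?thesis using err[of x y] by linarith
  qed
  moreover have "Re (h x y) \<le> - 29 / 60" if "R x y \<le> - d" for x y
  proof -
    have "2 / 3 * G \<le> fejer_integral n (- R x y)" unfolding G_def
      using that d bounded[of x y] by (intro fejer_integral_step[of n d]) (auto simp: R_def)
    then have "2 / 3 \<le> - fejer_integral n (R x y) / G" using G by (simp add: field_simps fejer_integral_minus)
    then show ?thesis using err[of x y] by linarith
  qed
  ultimately show ?thesis using h unfolding R_def W_def by blast
qed

subsection \<open>Bounding the approximate rank\<close>

lemma log_rank_ge_1: "1 \<le> log_rank A"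
  by (simp add: log_rank_def le_log_iff)

lemma mat_rank_le_two_powr_log_rank: "real (mat_rank A) \<le> 2 powr log_rank A"
  by (simp add: log_rank_def)

lemma nat_ceiling_le_add_1: "0 \<le> x \<Longrightarrow> real (nat \<lceil>x\<rceil>) \<le> x + 1"
  by linarith

lemma comm_fun_values:
  assumes "comm_fun n m F" "p \<in> dom F"
  shows "the (F p) = 1 \<or> the (F p) = -1"
  using assms ranI[of F p] unfolding comm_fun_def by fastforce

lemma power_floor_log:
  assumes "1 \<le> (w::real)"
  shows "2 ^ nat \<lfloor>log 2 w\<rfloor> \<le> w" "w < 2 ^ Suc (nat \<lfloor>log 2 w\<rfloor>)"
proof -
  have l: "0 \<le> log 2 w" using assms by simp
  have "2 powr real (nat \<lfloor>log 2 w\<rfloor>) \<le> 2 powr log 2 w" using l by (intro powr_mono) auto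
  also have "2 powr real (nat \<lfloor>log 2 w\<rfloor>) = 2 ^ nat \<lfloor>log 2 w\<rfloor>" by (rule powr_realpow) simp
  finally show "2 ^ nat \<lfloor>log 2 w\<rfloor> \<le> w" using assms by simp
  have "2 powr log 2 w < 2 powr real (Suc (nat \<lfloor>log 2 w\<rfloor>))"
    using l by (intro powr_less_mono) linarith+
  then show "w < 2 ^ Suc (nat \<lfloor>log 2 w\<rfloor>)" using assms by (simp add: powr_realpow del: power_Suc of_nat_Suc)
qed

text \<open>The choice of \<open>q\<close> makes \<open>e = exp (- q)\<close> at most
  \<open>1 / (64 * n * s)\<close>, and \<open>(1 + e) ^ s - 1\<close> is at most
  \<open>2 * s * e\<close> because \<open>s * e\<close> is at most 1.\<close>

lemma truncation_parameter:
  assumes "1 \<le> n" "1 \<le> s"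
  defines "q \<equiv> nat \<lceil>ln (64 * real n * real s)\<rceil>"
  shows "1 \<le> q" "real q \<le> log 2 (64 * real n * real s) + 1"
    and "real n * ((1 + exp (- real q)) ^ s - 1) \<le> 1 / 32"
proof -
  let ?p = "64 * real n * real s"
  have ns: "1 \<le> real n * real s" using assms(1,2) by (metis mult_le_mono of_nat_1 of_nat_le_iff of_nat_mult mult_1)
  have p: "64 \<le> ?p" using ns by simp
  have ln1: "1 \<le> ln ?p" using p exp_le by (subst ln_ge_iff) auto
  have q: "ln ?p \<le> real q" "real q \<le> ln ?p + 1" unfolding q_def using ln1 by linarith+
  show "1 \<le> q" using q(1) ln1 by linarith
  have "ln ?p \<le> log 2 ?p" using ln1 ln_2_less_1
    by (simp add: log_def le_divide_eq mult_left_le)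
  then show "real q \<le> log 2 ?p + 1" using q(2) by simp
  define e where "e = exp (- real q)"
  have "e \<le> exp (- ln ?p)" using q(1) by (simp add: e_def)
  also have "\<dots> = 1 / ?p" using p by (simp add: exp_minus inverse_eq_divide)
  finally have e: "real n * (real s * e) \<le> 1 / 64" using ns by (simp add: field_simps)
  have e0: "0 \<le> e" by (simp add: e_def)
  have "1 * (real s * e) \<le> real n * (real s * e)" using assms(1) e0 by (intro mult_right_mono) auto
  then have se: "real s * e \<le> 1" using e by simp
  have "(1 + e) ^ s \<le> exp e ^ s" using e0 by (intro power_mono exp_ge_add_one_self) auto
  also have "\<dots> = exp (real s * e)" by (simp add: exp_of_nat_mult)
  also have "\<dots> \<le> 1 + real s * e + (real s * e)\<^sup>2" using se e0 by (intro exp_le_quadratic) auto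
  also have "\<dots> \<le> 1 + 2 * (real s * e)"
  proof -
    have "(real s * e) * (real s * e) \<le> (real s * e) * 1" using se e0 by (intro mult_left_mono) auto
    then show ?thesis unfolding power2_eq_square by linarith
  qed
  finally have "real n * ((1 + e) ^ s - 1) \<le> real n * (2 * (real s * e))" by (intro mult_left_mono) auto
  then show "real n * ((1 + e) ^ s - 1) \<le> 1 / 32" using e by simp
qed

text \<open>Sparsification with error 1/10, whence 1600 = 16 * 10 * 10 and the lower bound 1/40 on
  \<open>M\<close>; the entries stay below 19/20 and the margin above 1/3.\<close>

lemma approx_rank_le_mixture:
  assumes F: "comm_fun n m F" and nm: "0 < n" "0 < m"
    and h: "mixture W M h" and M: "1 / 40 \<le> M"
    and bounded: "\<And>x y. \<bar>Re (h x y)\<bar> \<le> 17 / 20"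
    and approx: "\<And>x y. (x, y) \<in> dom F \<Longrightarrow> 29 / 60 \<le> the (F (x, y)) * Re (h x y)"
  shows "real (approx_rank n m F) \<le> (1600 * M\<^sup>2 * ln (2 * real (n * m)) + 1) * 2 ^ W"
proof -
  let ?E = "{..<n} \<times> {..<m}"
  have card: "card ?E = n * m" by (simp add: card_cartesian_product)
  have nm1: "1 \<le> real (n * m)" using nm by (simp add: Suc_leI flip: of_nat_mult)
  have lnpos: "0 < ln (2 * real (n * m))" using nm1 by (intro ln_gt_zero) linarith
  define N where "N = nat \<lceil>1600 * M\<^sup>2 * ln (2 * real (n * m))\<rceil>"
  have pos: "0 < 1600 * M\<^sup>2 * ln (2 * real (n * m))" using M lnpos by (intro mult_pos_pos) auto
  have N: "1600 * M\<^sup>2 * ln (2 * real (n * m)) \<le> real N"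
    "real N \<le> 1600 * M\<^sup>2 * ln (2 * real (n * m)) + 1" unfolding N_def using pos by linarith+
  have "\<exists>Z. factorable (N * 2 ^ W) Z \<and> (\<forall>(x, y)\<in>?E. \<bar>Z x y - Re (h x y)\<bar> \<le> 1 / 10)"
  proof (rule mixture_sparsify[OF h])
    show "0 < N" using N(1) pos by (metis less_le_trans of_nat_0_less_iff)
    show "16 * M\<^sup>2 * ln (real (2 * card ?E)) \<le> (1 / 10)\<^sup>2 * real N"
      using N(1) unfolding card by (simp add: power2_eq_square)
  qed (use nm M in auto)
  then obtain Z where Z: "factorable (N * 2 ^ W) Z"
    "\<And>x y. x < n \<Longrightarrow> y < m \<Longrightarrow> \<bar>Z x y - Re (h x y)\<bar> \<le> 1 / 10" by fastforce
  let ?B = "mat n m (\<lambda>(x, y). Z x y)"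
  have "\<bar>?B $$ (x, y)\<bar> \<le> 1" if "x < n" "y < m" for x y
  proof -
    have "\<bar>Z x y\<bar> \<le> 1" using Z(2)[of x y] bounded[of x y] that by linarith
    then show ?thesis using that by simp
  qed
  moreover have "1 / 3 \<le> the (F (x, y)) * ?B $$ (x, y)" if xy: "(x, y) \<in> dom F" for x y
  proof -
    have r: "x < n" "y < m" using F xy by (auto simp: comm_fun_def)
    have "the (F (x, y)) = 1 \<or> the (F (x, y)) = -1"
      using comm_fun_values[OF F] xy by simp
    moreover have "Re (h x y) - 1 / 10 \<le> Z x y" "Z x y \<le> Re (h x y) + 1 / 10"
      using Z(2)[OF r] by linarith+
    ultimately show ?thesis using approx[OF xy] r by auto
  qed
  moreover have "?B \<in> carrier_mat n m" by simp
  ultimately have "?B \<in> approximating_mats n m F"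
    unfolding approximating_mats_def unit_bounded_mats_def by blast
  then have "approx_rank n m F \<le> mat_rank ?B" unfolding approx_rank_def by (intro Least_le) auto
  also have "\<dots> \<le> N * 2 ^ W" by (rule mat_rank_le[OF Z(1)])
  finally have "real (approx_rank n m F) \<le> real (N * 2 ^ W)" by (simp only: of_nat_le_iff)
  also have "\<dots> \<le> (1600 * M\<^sup>2 * ln (2 * real (n * m)) + 1) * 2 ^ W"
    using N(2) by (simp add: mult_right_mono)
  finally show ?thesis .
qed

text \<open>Scale \<open>i\<close> costs \<open>6 * k + 2 * (1 + q) * 2 ^ i\<close>. The first part
  is the same for each of the logarithmically many scales, and the second sums geometrically to
  \<open>O(q * T)\<close>, so both are \<open>O(T * log T)\<close>.\<close>

lemma rank_exponent_le:
  fixes K :: "nat \<Rightarrow> nat"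
  defines "s T \<equiv> Suc (nat \<lfloor>log 2 T\<rfloor>)"
  assumes T: "1 \<le> T" and k: "1 \<le> k" "real k \<le> 129 * T"
    and q: "real q \<le> log 2 (64 * real k * real (s T)) + 1"
    and K: "\<And>i. real (K i) \<le> 3 * real k / 2 ^ i + (1 + real q)"
  shows "11 + 12 * real k + real (\<Sum>i<s T. K i * 2 ^ Suc i) \<le> 3183 * (T * log 2 (T + 2))"
proof -
  define u where "u = s T"
  have u0: "0 < u" by (simp add: u_def s_def)
  define l where "l = log 2 (T + 2)"
  have l1: "1 \<le> l" using T by (simp add: l_def le_log_iff)
  have lT: "log 2 T \<le> l" unfolding l_def using T by simp
  have "real u = real (nat \<lfloor>log 2 T\<rfloor>) + 1" by (simp add: u_def s_def)
  also have "\<dots> \<le> log 2 T + 1" using T by simp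
  finally have u2: "real u \<le> 2 * l" using l1 lT by linarith
  have "2 ^ nat \<lfloor>log 2 T\<rfloor> \<le> T" using power_floor_log(1)[OF T] .
  then have u2T: "2 ^ u \<le> 2 * T" by (simp add: u_def s_def)
  have "real u \<le> 2 ^ u" by (simp add: less_imp_le)
  then have "real u \<le> 2 * T" using u2T by (rule order_trans)
  then have "64 * real k * real u \<le> 64 * (129 * T) * (2 * T)"
    using k T by (intro mult_mono) auto
  also have "\<dots> \<le> 2 ^ 15 * (T + 2)\<^sup>2" using T by (simp add: power2_eq_square algebra_simps)
  finally have "log 2 (64 * real k * real u) \<le> log 2 (2 ^ 15 * (T + 2)\<^sup>2)"
    using k(1) T u0 by (subst log_le_cancel_iff) auto
  also have "\<dots> = 15 + 2 * l"
  proof -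
    have "log 2 (2 ^ 15) = 15" by (subst log_pow_cancel) auto
    moreover have "log 2 ((T + 2)\<^sup>2) = 2 * l" using T by (simp add: log_nat_power l_def)
    moreover have "log 2 (2 ^ 15 * (T + 2)\<^sup>2) = log 2 (2 ^ 15) + log 2 ((T + 2)\<^sup>2)"
      using T by (intro log_mult_pos) auto
    ultimately show ?thesis by (simp only:)
  qed
  finally have q19: "1 + real q \<le> 19 * l" using q l1 unfolding u_def[symmetric] by linarith
  have two: "(\<Sum>i<u. 2 ^ i) = (2::real) ^ u - 1" by (induction u) auto
  have "real (\<Sum>i<u. K i * 2 ^ Suc i) = (\<Sum>i<u. real (K i) * 2 ^ Suc i)" by simp
  also have "\<dots> \<le> (\<Sum>i<u. (3 * real k / 2 ^ i + (1 + real q)) * 2 ^ Suc i)"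
    using K by (intro sum_mono mult_right_mono) auto
  also have "\<dots> = (\<Sum>i<u. 6 * real k + 2 * (1 + real q) * 2 ^ i)"
    by (intro sum.cong refl) (simp add: distrib_right)
  also have "\<dots> = real u * (6 * real k) + 2 * (1 + real q) * (2 ^ u - 1)"
    unfolding sum.distrib sum_distrib_left[symmetric] two by simp
  also have "\<dots> \<le> (2 * l) * (6 * (129 * T)) + 2 * (19 * l) * (2 * T)"
  proof (rule add_mono)
    show "real u * (6 * real k) \<le> (2 * l) * (6 * (129 * T))"
      using u2 k l1 by (intro mult_mono) auto
    show "2 * (1 + real q) * (2 ^ u - 1) \<le> 2 * (19 * l) * (2 * T)"
    proof (rule mult_mono)
      show "2 * (1 + real q) \<le> 2 * (19 * l)" using q19 by simp
      show "2 ^ u - 1 \<le> 2 * T" using u2T by linarith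
      show "0 \<le> 2 * (19 * l)" using l1 by simp
    qed simp
  qed
  also have "\<dots> = 1624 * (T * l)" by simp
  finally have "real (\<Sum>i<u. K i * 2 ^ Suc i) \<le> 1624 * (T * l)" .
  moreover have "T \<le> T * l" using mult_left_mono[OF l1, of T] T by simp
  \<comment> \<open>The constant is 11 + 12 * 129 + 1624.\<close>
  ultimately have "11 + 12 * real k + real (\<Sum>i<u. K i * 2 ^ Suc i) \<le> 3183 * (T * l)"
    using k T by linarith
  then show ?thesis by (simp only: l_def u_def)
qed

text \<open>\<open>M\<close> is at most \<open>exp (4 * k)\<close>, and \<open>exp (8 * k)\<close>
  is at most \<open>2 powr (12 * k)\<close> because \<open>ln 2\<close> is at least 2/3; the factor
  1600 and the summand 1 fit into \<open>2 ^ 11\<close>.\<close>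

lemma sample_size_le:
  fixes k p :: nat
  defines "M \<equiv> 2 * real k * exp (2 * real k)"
  assumes p: "1 \<le> p"
  shows "1600 * M\<^sup>2 * ln (2 * real p) + 1 \<le> 2 powr (11 + 12 * real k) * (1 + log 2 (real p))"
proof -
  define l where "l = 1 + log 2 (real p)"
  define P where "P = 2 powr (12 * real k)"
  have ll: "log 2 (2 * real p) = l" using p by (simp add: l_def log_mult)
  have l1: "1 \<le> l" using p by (simp add: l_def)
  have "ln (2 * real p) = l * ln 2" using ll by (simp add: log_def field_simps)
  also have "\<dots> \<le> l * 1" using l1 ln_2_less_1 by (intro mult_left_mono) auto
  finally have lnl: "ln (2 * real p) \<le> l" by simp
  have M0: "0 \<le> M" by (simp add: M_def)
  have "2 * real k \<le> exp (2 * real k)" using exp_ge_add_one_self[of "2 * real k"] by linarith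
  then have "M \<le> exp (2 * real k) * exp (2 * real k)" unfolding M_def by (intro mult_right_mono) auto
  also have "\<dots> = exp (4 * real k)" by (simp add: exp_add[symmetric])
  finally have "M\<^sup>2 \<le> (exp (4 * real k))\<^sup>2" using M0 by (intro power_mono) auto
  also have "\<dots> = exp (8 * real k)" by (simp add: power2_eq_square exp_add[symmetric])
  also have "\<dots> \<le> exp (12 * real k * ln 2)"
    using mult_left_mono[OF ln2_ge_two_thirds, of "12 * real k"] by (simp only: exp_le_cancel_iff) simp
  also have "\<dots> = P" by (simp add: powr_def P_def)
  finally have M2: "M\<^sup>2 \<le> P" .
  have P1: "1 \<le> P" by (simp add: P_def ge_one_powr_ge_zero)
  have "M\<^sup>2 * ln (2 * real p) \<le> P * l" using M2 lnl P1 p by (intro mult_mono) auto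
  moreover have "1 * 1 \<le> P * l" using P1 l1 by (intro mult_mono) auto
  ultimately have "1600 * (M\<^sup>2 * ln (2 * real p)) + 1 \<le> 2048 * (P * l)" by linarith
  moreover have "2 powr (11 + 12 * real k) = 2048 * P"
    unfolding P_def powr_add by simp
  ultimately show ?thesis unfolding l_def by (simp only: mult.assoc)
qed

text \<open>Turns the outcome of multiplicative weights into an approximating matrix. The bound is
  independent of \<open>N\<close>, since only the mass of the normalized combination
  matters.\<close>

lemma approx_rank_le_of_correlated:
  assumes F: "comm_fun n m F" and nm: "0 < n" "0 < m" and T: "1 \<le> T" and N: "0 < N"
    and A: "\<And>j. j < N \<Longrightarrow> A j \<in> unit_bounded_mats n m" "\<And>j. j < N \<Longrightarrow> log_rank (A j) \<le> T"
    and corr: "\<And>x y. (x, y) \<in> dom F \<Longrightarrow>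
      real N / (2 * T) \<le> (\<Sum>j<N. the (F (x, y)) * A j $$ (x, y) / log_rank (A j))"
  shows "real (approx_rank n m F) \<le> 2 powr (3183 * (T * log 2 (T + 2))) * (1 + log 2 (real (n * m)))"
proof -
  define w where "w j = log_rank (A j)" for j
  have w1: "1 \<le> w j" for j by (simp add: w_def log_rank_ge_1)
  define b where "b j = nat \<lfloor>log 2 (w j)\<rfloor>" for j
  define s where "s = Suc (nat \<lfloor>log 2 T\<rfloor>)"
  have bs: "b j < s" if "j < N" for j
  proof -
    have "log 2 (w j) \<le> log 2 T" using A(2)[OF that] w1[of j] by (simp add: w_def)
    then show ?thesis by (auto simp: b_def s_def less_Suc_eq_le intro!: nat_mono floor_mono)
  qed
  define a where "a j x y = (if x < n \<and> y < m then A j $$ (x, y) else 0)" for j x y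
  have a1: "\<bar>a j x y\<bar> \<le> 1" if "j < N" for j x y
    using A(1)[OF that] by (auto simp: a_def unit_bounded_mats_def)
  define S where "S i x y = (\<Sum>j\<in>{j\<in>{..<N}. b j = i}. 1 / (real N * w j) * a j x y)" for i x y
  have sumS: "(\<Sum>i<s. S i x y) = (\<Sum>j<N. 1 / (real N * w j) * a j x y)" for x y
    unfolding S_def using bs by (intro sum.group) auto
  \<comment> \<open>In class \<open>i\<close> the log-rank is below \<open>2 ^ Suc i\<close>, which
    bounds the rank, and at least \<open>2 ^ i\<close>, which bounds each of the at most
    \<open>N\<close> coefficients by \<open>1 / (N * 2 ^ i)\<close>.\<close>
  have mixS: "mixture (2 ^ Suc i) (1 / 2 ^ i) (\<lambda>x y. complex_of_real (S i x y))" for i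
  proof -
    have "mixture (2 ^ Suc i) (\<Sum>j\<in>{j\<in>{..<N}. b j = i}. 1 / (real N * 2 ^ i))
      (\<lambda>x y. \<Sum>j\<in>{j\<in>{..<N}. b j = i}. complex_of_real (1 / (real N * w j)) * complex_of_real (a j x y))"
    proof (intro mixture_sum mixture_cmult_real)
      fix j assume j: "j \<in> {j\<in>{..<N}. b j = i}"
      have wi: "2 ^ i \<le> w j" "w j < 2 ^ Suc i"
        using power_floor_log[OF w1[of j]] j by (auto simp: b_def)
      have "real (mat_rank (A j)) \<le> 2 powr w j"
        unfolding w_def by (rule mat_rank_le_two_powr_log_rank)
      also have "\<dots> \<le> 2 powr real (2 ^ Suc i)" using wi by (intro powr_mono) auto
      also have "\<dots> = real (2 ^ (2 ^ Suc i))" by (subst powr_realpow) auto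
      finally have "mat_rank (A j) \<le> 2 ^ (2 ^ Suc i)" by (simp only: of_nat_le_iff)
      moreover have "factorable (mat_rank (A j)) (a j)"
        unfolding a_def using A(1)[of j] j by (intro factorable_mat_rank) (auto simp: unit_bounded_mats_def)
      ultimately show "factorable (2 ^ 2 ^ Suc i) (a j)" by (rule factorable_mono[rotated])
      show "\<bar>a j x y\<bar> \<le> 1" for x y using a1 j by simp
      have "1 / (real N * w j) \<le> 1 / (real N * 2 ^ i)"
        using wi N by (intro divide_left_mono mult_left_mono mult_pos_pos) (auto intro: less_le_trans[OF _ wi(1)])
      moreover have "0 \<le> 1 / (real N * w j)" using w1[of j] by simp
      ultimately show "norm (complex_of_real (1 / (real N * w j))) \<le> 1 / (real N * 2 ^ i)"
        by (simp only: norm_of_real abs_of_nonneg)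
    qed auto
    moreover have "(\<Sum>j\<in>{j\<in>{..<N}. b j = i}. 1 / (real N * 2 ^ i)) \<le> 1 / 2 ^ i"
    proof -
      have "card {j\<in>{..<N}. b j = i} \<le> card {..<N}" by (intro card_mono) auto
      then show ?thesis using N by (simp add: field_simps)
    qed
    ultimately show ?thesis by (auto simp: S_def intro: mixture_mono)
  qed
  \<comment> \<open>Against the margin \<open>1 / (2 * T)\<close>, a degree of at least
    \<open>128 * T\<close> gives the product 64 required by \<open>mixture_sign\<close>.\<close>
  define k where "k = nat \<lceil>128 * T\<rceil>"
  have k: "128 * T \<le> real k" "real k \<le> 129 * T" using T unfolding k_def by linarith+
  have k1: "1 \<le> k" using k(1) T by linarith
  define q where "q = nat \<lceil>ln (64 * real k * real s)\<rceil>"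
  have s1: "1 \<le> s" by (simp add: s_def)
  note q = truncation_parameter[OF k1 s1, folded q_def]
  define K where "K i = nat \<lceil>3 * real k / 2 ^ i\<rceil> + q" for i
  have K: "3 * real k / 2 ^ i + real q \<le> real (K i)" for i
    unfolding K_def by (simp add: real_nat_ceiling_ge)
  define W where "W = (\<Sum>i<s. K i * 2 ^ Suc i)"
  define M where "M = 2 * real k * exp (2 * real k)"
  have "\<bar>\<Sum>i<s. S i x y\<bar> \<le> 1" for x y
  proof -
    have "\<bar>\<Sum>i<s. S i x y\<bar> \<le> (\<Sum>j<N. 1 / real N)"
      unfolding sumS
    proof (intro order_trans[OF sum_abs] sum_mono)
      fix j assume "j \<in> {..<N}"
      then have "1 / (real N * w j) * \<bar>a j x y\<bar> \<le> 1 / (real N * 1) * 1"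
        using a1 w1[of j] N by (intro mult_mono divide_left_mono mult_left_mono) auto
      then show "\<bar>1 / (real N * w j) * a j x y\<bar> \<le> 1 / real N" using w1[of j] by (simp add: abs_mult)
    qed
    then show ?thesis using N by simp
  qed
  moreover have "64 \<le> real k * (1 / (2 * T))" using k(1) T by (simp add: field_simps)
  ultimately obtain h where h: "mixture W M h" "\<And>x y. \<bar>Re (h x y)\<bar> \<le> 17 / 20"
    "\<And>x y. 1 / (2 * T) \<le> (\<Sum>i<s. S i x y) \<Longrightarrow> 29 / 60 \<le> Re (h x y)"
    "\<And>x y. (\<Sum>i<s. S i x y) \<le> - (1 / (2 * T)) \<Longrightarrow> Re (h x y) \<le> - 29 / 60"
    using mixture_sign[OF mixS K q(1) k1 q(3), of "1 / (2 * T)"] T unfolding W_def M_def by auto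
  have "1 \<le> exp (2 * real k)" by simp
  then have M1: "2 \<le> M" unfolding M_def using k1 mult_mono[of 1 "real k" 1 "exp (2 * real k)"] by simp
  have "29 / 60 \<le> the (F (x, y)) * Re (h x y)" if xy: "(x, y) \<in> dom F" for x y
  proof -
    have r: "x < n" "y < m" using F xy by (auto simp: comm_fun_def)
    have "1 / (2 * T) \<le> (\<Sum>j<N. the (F (x, y)) * A j $$ (x, y) / w j) / real N"
      using corr[OF xy] N T by (simp add: w_def field_simps)
    also have "\<dots> = the (F (x, y)) * (\<Sum>i<s. S i x y)"
      unfolding sumS using r by (simp add: a_def sum_distrib_left sum_divide_distrib mult_ac)
    finally have "1 / (2 * T) \<le> the (F (x, y)) * (\<Sum>i<s. S i x y)" .
    moreover have "the (F (x, y)) = 1 \<or> the (F (x, y)) = -1"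
      using comm_fun_values[OF F] xy by simp
    ultimately show ?thesis using h(3)[of x y] h(4)[of x y] by auto
  qed
  then have "real (approx_rank n m F) \<le> (1600 * M\<^sup>2 * ln (2 * real (n * m)) + 1) * 2 ^ W"
    using h M1 by (intro approx_rank_le_mixture[OF F nm h(1)]) auto
  also have "\<dots> \<le> (2 powr (11 + 12 * real k) * (1 + log 2 (real (n * m)))) * 2 powr real W"
  proof -
    have "1600 * M\<^sup>2 * ln (2 * real (n * m)) + 1 \<le> 2 powr (11 + 12 * real k) * (1 + log 2 (real (n * m)))"
      unfolding M_def using nm by (intro sample_size_le) simp
    moreover have "2 powr real W = 2 ^ W" by (rule powr_realpow) simp
    ultimately show ?thesis by (simp only: mult_right_mono zero_le_power zero_le_numeral)
  qed
  also have "\<dots> = 2 powr (11 + 12 * real k + real W) * (1 + log 2 (real (n * m)))"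
    by (simp add: powr_add)
  also have "\<dots> \<le> 2 powr (3183 * (T * log 2 (T + 2))) * (1 + log 2 (real (n * m)))"
  proof (intro mult_right_mono powr_mono)
    show "11 + 12 * real k + real W \<le> 3183 * (T * log 2 (T + 2))"
      unfolding W_def s_def
    proof (rule rank_exponent_le[OF T k1 k(2)])
      show "real q \<le> log 2 (64 * real k * real (Suc (nat \<lfloor>log 2 T\<rfloor>))) + 1"
        using q(2) unfolding s_def .
      show "real (K i) \<le> 3 * real k / 2 ^ i + (1 + real q)" for i
      proof -
        have "0 \<le> 3 * real k / 2 ^ i" by simp
        then have "real (nat \<lceil>3 * real k / 2 ^ i\<rceil>) \<le> 3 * real k / 2 ^ i + 1"
          by (rule nat_ceiling_le_add_1)
        then show ?thesis by (simp add: K_def)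
      qed
    qed
    have "1 \<le> real (n * m)" using nm by (simp add: Suc_leI flip: of_nat_mult)
    then show "0 \<le> 1 + log 2 (real (n * m))" by simp
  qed simp
  finally show ?thesis .
qed

subsection \<open>The hard distribution\<close>

lemma pmf_of_weights:
  fixes w :: "'a \<Rightarrow> real"
  assumes E: "finite E" "E \<noteq> {}" and w: "\<And>e. e \<in> E \<Longrightarrow> 0 < w e"
  shows "\<exists>\<mu>. set_pmf \<mu> \<subseteq> E \<and>
    (\<forall>f. measure_pmf.expectation \<mu> f = (\<Sum>e\<in>E. w e * f e) / (\<Sum>e\<in>E. w e))"
proof -
  define t where "t = (\<Sum>e\<in>E. w e)"
  have t: "0 < t" unfolding t_def using assms by (intro sum_pos) auto
  define p where "p e = (if e \<in> E then w e / t else 0)" for e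
  have p0: "0 \<le> p e" for e using w[of e] t by (auto simp: p_def less_imp_le)
  have "(\<integral>\<^sup>+e. ennreal (p e) \<partial>count_space UNIV) = (\<Sum>e\<in>E. ennreal (p e))"
    using E by (intro nn_integral_count_space') (auto simp: p_def)
  also have "\<dots> = ennreal (\<Sum>e\<in>E. p e)" using p0 by (simp add: sum_ennreal)
  also have "(\<Sum>e\<in>E. p e) = 1" using t by (simp add: p_def sum_divide_distrib[symmetric] t_def)
  finally have p1: "(\<integral>\<^sup>+e. ennreal (p e) \<partial>count_space UNIV) = 1" by simp
  have pmf: "pmf (embed_pmf p) e = p e" for e using p0 p1 by (rule pmf_embed_pmf)
  have set: "set_pmf (embed_pmf p) \<subseteq> E"
    by (auto simp: set_pmf_eq pmf p_def split: if_splits)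
  have "measure_pmf.expectation (embed_pmf p) f = (\<Sum>e\<in>E. w e * f e) / t" for f
  proof -
    have "measure_pmf.expectation (embed_pmf p) f = (\<Sum>e\<in>E. f e * pmf (embed_pmf p) e)"
      using E set by (intro integral_measure_pmf_real) auto
    then show ?thesis by (simp add: pmf p_def sum_divide_distrib mult.commute)
  qed
  then show ?thesis using set unfolding t_def by blast
qed

lemma ex_hard_distribution:
  assumes F: "comm_fun n m F" "dom F \<noteq> {}" and T: "1 < T"
    and large: "2 powr (3183 * (T * log 2 (T + 2))) * (1 + log 2 (real (n * m))) < real (approx_rank n m F)"
  shows "\<exists>\<mu>. set_pmf \<mu> \<subseteq> dom F \<and> (\<forall>A\<in>unit_bounded_mats n m.
    measure_pmf.expectation \<mu> (\<lambda>(x, y). the (F (x, y)) * A $$ (x, y)) \<le> log_rank A / T)"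
proof (rule ccontr)
  assume neg: "\<not> ?thesis"
  have sub: "dom F \<subseteq> {..<n} \<times> {..<m}" using F by (simp add: comm_fun_def)
  have fin: "finite (dom F)" using sub by (rule finite_subset) simp
  have nm: "0 < n" "0 < m" using F(2) sub by (auto intro: Nat.gr0I)
  define val where "val A p = (case p of (x, y) \<Rightarrow> the (F (x, y)) * A $$ (x, y) / log_rank A)" for A p
  \<comment> \<open>This restriction loses nothing: correlations are at most 1, so a matrix of
    correlation above \<open>log_rank A / T\<close> has log-rank below \<open>T\<close>.\<close>
  define U where "U = {A \<in> unit_bounded_mats n m. log_rank A \<le> T}"
  have abs1: "\<bar>the (F (x, y)) * A $$ (x, y)\<bar> \<le> 1"
    if "A \<in> unit_bounded_mats n m" "(x, y) \<in> dom F" for A x y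
  proof -
    have "\<bar>the (F (x, y))\<bar> = 1" using comm_fun_values[OF F(1) that(2)] by auto
    then show ?thesis using that sub by (auto simp: abs_mult unit_bounded_mats_def)
  qed
  \<comment> \<open>The loss \<open>2 * l\<close> is half of the advantage \<open>1 / T\<close>,
    leaving the margin \<open>1 / (2 * T)\<close>.\<close>
  define l where "l = 1 / (4 * T)"
  \<comment> \<open>\<open>Suc\<close> keeps \<open>N\<close> positive when \<open>dom F\<close> is
    a singleton and the logarithm is 0.\<close>
  define N where "N = Suc (nat \<lceil>ln (card (dom F)) / l\<^sup>2\<rceil>)"
  have "\<exists>A. (\<forall>j<N. A j \<in> U) \<and> (\<forall>p\<in>dom F. real N * (1 / T - 2 * l) \<le> (\<Sum>j<N. val (A j) p))"
  proof (rule multiplicative_weights)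
    show "0 < l" "l \<le> 1" using T by (auto simp: l_def)
    then have "ln (card (dom F)) / l\<^sup>2 \<le> real N" unfolding N_def by linarith
    then show "ln (card (dom F)) \<le> l\<^sup>2 * real N" using \<open>0 < l\<close> by (simp add: divide_le_eq mult.commute)
  next
    fix A p assume A: "A \<in> U" and p: "p \<in> dom F"
    obtain x y where [simp]: "p = (x, y)" by force
    have "\<bar>the (F (x, y)) * A $$ (x, y)\<bar> \<le> log_rank A"
      using abs1[of A x y] A p log_rank_ge_1[of A] by (auto simp: U_def)
    then show "\<bar>val A p\<bar> \<le> 1" using log_rank_ge_1[of A] by (simp add: val_def)
  next
    fix w :: "nat \<times> nat \<Rightarrow> real" assume w: "\<And>e. e \<in> dom F \<Longrightarrow> 0 < w e"
    obtain \<mu> where \<mu>: "set_pmf \<mu> \<subseteq> dom F"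
      "\<And>f. measure_pmf.expectation \<mu> f = (\<Sum>e\<in>dom F. w e * f e) / (\<Sum>e\<in>dom F. w e)"
      using pmf_of_weights[OF fin F(2), of w] w by blast
    have "\<not> (\<forall>A\<in>unit_bounded_mats n m.
        measure_pmf.expectation \<mu> (\<lambda>(x, y). the (F (x, y)) * A $$ (x, y)) \<le> log_rank A / T)"
      using neg \<mu>(1) by blast
    then obtain A where A: "A \<in> unit_bounded_mats n m"
      and lt: "log_rank A / T < measure_pmf.expectation \<mu> (\<lambda>(x, y). the (F (x, y)) * A $$ (x, y))"
      unfolding Ball_def not_all not_imp not_le by blast
    define t where "t = (\<Sum>e\<in>dom F. w e)"
    have t: "0 < t" unfolding t_def using w fin F(2) by (intro sum_pos) auto
    define c where "c = (\<Sum>e\<in>dom F. w e * (case e of (x, y) \<Rightarrow> the (F (x, y)) * A $$ (x, y)))"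
    have lt': "log_rank A / T < c / t" using lt by (simp add: \<mu>(2) c_def t_def)
    have "c \<le> (\<Sum>e\<in>dom F. w e * 1)" unfolding c_def
    proof (intro sum_mono mult_left_mono)
      fix e assume e: "e \<in> dom F"
      obtain x y where [simp]: "e = (x, y)" by force
      show "(case e of (x, y) \<Rightarrow> the (F (x, y)) * A $$ (x, y)) \<le> 1"
        using abs1[OF A, of x y] e by (simp add: abs_le_iff)
      show "0 \<le> w e" using w[OF e] by simp
    qed
    then have "c / t \<le> 1" using t by (simp add: t_def)
    then have "log_rank A / T \<le> 1" using lt' by linarith
    then have "log_rank A \<le> T" using T by (simp add: divide_le_eq)
    then have "A \<in> U" using A by (simp add: U_def)
    moreover have "(\<Sum>e\<in>dom F. w e * val A e) = c / log_rank A"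
      by (simp add: c_def val_def sum_divide_distrib case_prod_beta)
    moreover have "1 / T * t \<le> c / log_rank A"
      using lt' t T log_rank_ge_1[of A] by (simp add: field_simps)
    ultimately show "\<exists>A\<in>U. 1 / T * sum w (dom F) \<le> (\<Sum>e\<in>dom F. w e * val A e)"
      by (intro bexI[of _ A]) (auto simp: t_def)
  qed (use fin F in auto)
  then obtain A where A: "\<And>j. j < N \<Longrightarrow> A j \<in> U"
    "\<And>p. p \<in> dom F \<Longrightarrow> real N * (1 / T - 2 * l) \<le> (\<Sum>j<N. val (A j) p)" by blast
  have "real (approx_rank n m F) \<le> 2 powr (3183 * (T * log 2 (T + 2))) * (1 + log 2 (real (n * m)))"
  proof (rule approx_rank_le_of_correlated[OF F(1) nm])
    fix x y assume xy: "(x, y) \<in> dom F"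
    have "real N * (1 / T - 2 * l) = real N / (2 * T)" using T by (simp add: l_def field_simps)
    then show "real N / (2 * T) \<le> (\<Sum>j<N. the (F (x, y)) * A j $$ (x, y) / log_rank (A j))"
      using A(2)[OF xy] by (simp add: val_def)
  qed (use T A(1) in \<open>auto simp: U_def N_def\<close>)
  then show False using large by simp
qed

text \<open>The guard in the conclusion excludes approximate rank at most 1. There
  \<open>soft_Omega\<close> is 0 and so is the quotient, a bound violated by the constant function 1
  and the all-ones matrix.\<close>

theorem theorem6p8:
  "\<exists>C>0. \<exists>c>0. \<exists>k. \<forall>n m F.
     comm_fun n m F \<longrightarrow> dom F \<noteq> {} \<longrightarrow>
     log 2 (real (approx_rank n m F)) \<ge> C * log 2 (log 2 (real (card ({..<n} \<times> {..<m})))) \<longrightarrow>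
     (\<exists>\<mu> :: (nat \<times> nat) pmf. set_pmf \<mu> \<subseteq> dom F \<and>
        (\<forall>A \<in> unit_bounded_mats n m.
           log 2 (real (approx_rank n m F)) > 0 \<longrightarrow>
           measure_pmf.expectation \<mu> (\<lambda>(x, y). the (F (x, y)) * A $$ (x, y))
             \<le> log_rank A / soft_Omega c k (log 2 (real (approx_rank n m F)))))"
proof (rule exI[of _ 2], rule conjI, simp, rule exI[of _ "1 / 8000"], rule conjI, simp, rule exI[of _ 1],
    intro allI impI)
  fix n m F
  assume F: "comm_fun n m F" "dom F \<noteq> {}"
    and size: "2 * log 2 (log 2 (real (card ({..<n} \<times> {..<m})))) \<le> log 2 (real (approx_rank n m F))"
  define L where "L = log 2 (real (approx_rank n m F))"
  define T where "T = soft_Omega (1 / 8000) 1 L"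
  have sub: "dom F \<subseteq> {..<n} \<times> {..<m}" using F by (simp add: comm_fun_def)
  have fin: "finite (dom F)" using sub by (rule finite_subset) simp
  have nm: "0 < n" "0 < m" using F(2) sub by (auto intro: Nat.gr0I)
  \<comment> \<open>The first case is void. In the second the uniform distribution suffices, as
    correlations are at most 1 and \<open>log_rank A / T\<close> is at least 1. Only the third needs
    the hard distribution.\<close>
  consider "L \<le> 0" | "0 < L" "T \<le> 1" | "0 < L" "1 < T" by linarith
  then have "\<exists>\<mu>. set_pmf \<mu> \<subseteq> dom F \<and> (\<forall>A\<in>unit_bounded_mats n m. 0 < L \<longrightarrow>
    measure_pmf.expectation \<mu> (\<lambda>(x, y). the (F (x, y)) * A $$ (x, y)) \<le> log_rank A / T)"
  proof cases
    case 1
    then show ?thesis using fin F(2) by (intro exI[of _ "pmf_of_set (dom F)"]) auto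
  next
    case 2
    have "1 < log 2 (L + 2)" using 2(1) by (simp add: less_log_iff)
    then have T0: "0 < T" using 2(1) by (simp add: T_def soft_Omega_def)
    have "measure_pmf.expectation (pmf_of_set (dom F)) (\<lambda>(x, y). the (F (x, y)) * A $$ (x, y)) \<le> log_rank A / T"
      if A: "A \<in> unit_bounded_mats n m" for A
    proof -
      have "(\<Sum>(x, y)\<in>dom F. the (F (x, y)) * A $$ (x, y)) \<le> (\<Sum>p\<in>dom F. 1)"
      proof (rule sum_mono)
        fix p assume p: "p \<in> dom F"
        obtain x y where [simp]: "p = (x, y)" by force
        have "\<bar>A $$ (x, y)\<bar> \<le> 1" using A sub p by (auto simp: unit_bounded_mats_def)
        moreover have "the (F (x, y)) = 1 \<or> the (F (x, y)) = -1"
          using comm_fun_values[OF F(1)] p by simp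
        ultimately show "(case p of (x, y) \<Rightarrow> the (F (x, y)) * A $$ (x, y)) \<le> 1" by auto
      qed
      then have "measure_pmf.expectation (pmf_of_set (dom F)) (\<lambda>(x, y). the (F (x, y)) * A $$ (x, y)) \<le> 1"
        using fin F(2) by (simp add: integral_pmf_of_set divide_le_eq card_gt_0_iff)
      also have "\<dots> \<le> log_rank A / T" using T0 2(2) log_rank_ge_1[of A] by (simp add: field_simps)
      finally show ?thesis .
    qed
    then show ?thesis using fin F(2) by (intro exI[of _ "pmf_of_set (dom F)"]) auto
  next
    case 3
    let ?l = "log 2 (L + 2)"
    have l1: "1 < ?l" using 3(1) by (simp add: less_log_iff)
    have Tl: "T * ?l = L / 8000" using l1 by (simp add: T_def soft_Omega_def)
    have "T * 1 \<le> T * ?l" using 3 l1 by (intro mult_left_mono) auto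
    then have "T \<le> L" using Tl 3 by simp
    then have "T * log 2 (T + 2) \<le> T * ?l" using 3 by (intro mult_left_mono) auto
    then have Tb: "T * log 2 (T + 2) \<le> L / 8000" using Tl by simp
    have "1 * 1 \<le> T * ?l" using 3 l1 by (intro mult_mono) auto
    then have L8000: "8000 \<le> L" using Tl by simp
    have nm1: "1 \<le> n * m" using nm by (simp add: Suc_leI)
    have "1 + log 2 (real (n * m)) \<le> 2 powr (1 + L / 2)"
    proof (cases "n * m = 1")
      \<comment> \<open>Here \<open>log 2 1\<close> is 0, so the iterated logarithm in the size
        hypothesis takes a default value and carries no information.\<close>
      case True
      then show ?thesis using 3(1) by (simp add: ge_one_powr_ge_zero)
    next
      case False
      then have "2 \<le> real (n * m)" using nm1 by linarith
      then have u: "1 \<le> log 2 (real (n * m))" by (simp add: le_log_iff)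
      have "log 2 (log 2 (real (n * m))) \<le> L / 2" using size by (simp add: L_def card_cartesian_product)
      then have "2 powr log 2 (log 2 (real (n * m))) \<le> 2 powr (L / 2)" by (intro powr_mono) auto
      moreover have "2 powr log 2 (log 2 (real (n * m))) = log 2 (real (n * m))"
        using u by (intro powr_log_cancel) linarith+
      ultimately have "log 2 (real (n * m)) \<le> 2 powr (L / 2)" by (simp only:)
      then show ?thesis using u by (simp add: powr_add)
    qed
    then have "2 powr (3183 * (T * log 2 (T + 2))) * (1 + log 2 (real (n * m))) \<le>
        2 powr (3183 * (T * log 2 (T + 2))) * 2 powr (1 + L / 2)" by (intro mult_left_mono) auto
    also have "\<dots> = 2 powr (3183 * (T * log 2 (T + 2)) + (1 + L / 2))" by (simp add: powr_add)
    \<comment> \<open>The constant 1/8000 makes the first exponent at most 3183/8000 of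
      \<open>L\<close>, below 2/5, and the constant 2 in the size hypothesis gives
      \<open>L / 2\<close>. The remaining tenth of \<open>L\<close> exceeds 1.\<close>
    also have "\<dots> < 2 powr L" using Tb L8000 by (intro powr_less_mono) auto
    also have "2 powr L = real (approx_rank n m F)"
    proof -
      have "approx_rank n m F \<noteq> 0"
      proof
        assume "approx_rank n m F = 0"
        then have "L = 0" by (simp add: L_def log_def)
        then show False using 3(1) by simp
      qed
      then show ?thesis by (simp add: L_def)
    qed
    finally obtain \<mu> where "set_pmf \<mu> \<subseteq> dom F" "\<forall>A\<in>unit_bounded_mats n m.
        measure_pmf.expectation \<mu> (\<lambda>(x, y). the (F (x, y)) * A $$ (x, y)) \<le> log_rank A / T"
      using ex_hard_distribution[OF F 3(2)] by blast
    then show ?thesis by blast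
  qed
  then show "\<exists>\<mu>. set_pmf \<mu> \<subseteq> dom F \<and>
        (\<forall>A \<in> unit_bounded_mats n m.
           log 2 (real (approx_rank n m F)) > 0 \<longrightarrow>
           measure_pmf.expectation \<mu> (\<lambda>(x, y). the (F (x, y)) * A $$ (x, y))
             \<le> log_rank A / soft_Omega (1 / 8000) 1 (log 2 (real (approx_rank n m F))))"
    unfolding T_def L_def .
qed

end
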